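(* Let $\Delta$ be the Sierpiński triangle, let $0<\alpha\le1$, and let $f:\Delta\to\mathbb{R}$ be a 1-Hölder-$\alpha$ function, i.e. $|f(a)-f(b)|\le|a-b|^\alpha$ for all $a,b\in\Delta$. Let $h_B:(0,\tfrac13]\to\mathbb{R}$ be $$h_B(d)=\frac{(1-d)\log(1-d)-d\log d-(1-2d)\log(1-2d)+d\log 3}{\log 2}.$$ Then for Lebesgue almost every $r\in f(\Delta)$ we have $$\underline{\dim}_B(f^{-1}(r))\ge h_B^{-1}(\alpha).$$ Consequently, $D_{\underline{B}*}(\alpha,\Delta)\ge h_B^{-1}(\alpha)$.
   Context: The Sierpiński triangle is $\Delta=\bigcap_{n\ge 0}\Delta_n$, where $\Delta_0$ is a closed equilateral triangle of side length $1$ and $\Delta_n$ is the union of the $3^n$ closed triangles of side length $2^{-n}$ of the $n$th step of the standard construction. Here $h_B$ is strictly increasing on $(0,\frac13]$ with range containing $(0,1]$, and $h_B^{-1}$ is its inverse. $\underline{\dim}_B$ denotes lower box dimension. For compact $F\subset\mathbb{R}^p$ and $0<\alpha\le1$, $C_1^\alpha(F)$ is the set of $f:F\to\mathbb{R}$ with $|f(a)-f(b)|\le|a-b|^\alpha$ for all $a,b\in F$, with the topology of the supremum norm. For $f:F\to\mathbb{R}$ put $$D_{\underline{B}*}^f(F)=\sup\{d:\lambda(\{r:\underline{\dim}_B(f^{-1}(r))\ge d\})>0\},$$ where $\lambda$ is one-dimensional Lebesgue measure. Let $\mathfrak{G}_{1,\alpha}(F)$ be the collection of dense $G_\delta$ subsets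 of $C_1^\alpha(F)$, and $$D_{\underline{B}*}(\alpha,F)=\sup_{\mathcal{G}\in\mathfrak{G}_{1,\alpha}(F)}\ \inf\{D_{\underline{B}*}^f(F): f\in\mathcal{G}\}.$$ *)

theory Defs
  imports "HOL-Analysis.Analysis"
begin

text \<open>A triple stands for the closed triangle spanned by its three entries.\<close>

fun subdivide :: "'a::real_vector \<times> 'a \<times> 'a \<Rightarrow> ('a \<times> 'a \<times> 'a) set" where
  "subdivide (a, b, c) =
     {(a, midpoint a b, midpoint a c),
      (midpoint a b, b, midpoint b c),
      (midpoint a c, midpoint b c, c)}"

primrec step_triangles :: "'a::real_vector \<Rightarrow> 'a \<Rightarrow> 'a \<Rightarrow> nat \<Rightarrow> ('a \<times> 'a \<times> 'a) set" where
  "step_triangles a b c 0 = {(a, b, c)}"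
| "step_triangles a b c (Suc n) = (\<Union>T\<in>step_triangles a b c n. subdivide T)"

definition sierpinski_level :: "'a::real_vector \<Rightarrow> 'a \<Rightarrow> 'a \<Rightarrow> nat \<Rightarrow> 'a set" where
  "sierpinski_level a b c n = (\<Union>(p, q, r)\<in>step_triangles a b c n. convex hull {p, q, r})"

definition sierpinski :: "'a::real_vector \<Rightarrow> 'a \<Rightarrow> 'a \<Rightarrow> 'a set" where
  "sierpinski a b c = (\<Inter>n. sierpinski_level a b c n)"

text \<open>The smallest number of sets of diameter at most \<open>\<delta>\<close> that cover \<open>F\<close>.
  Boundedness is required because \<^const>\<open>diameter\<close> is unspecified on unbounded sets.\<close>

definition covering_number :: "real \<Rightarrow> 'a::metric_space set \<Rightarrow> nat" where
  "covering_number \<delta> F =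
     (LEAST n. \<exists>\<U>. finite \<U> \<and> card \<U> = n \<and> F \<subseteq> \<Union>\<U> \<and>
                   (\<forall>U\<in>\<U>. bounded U \<and> diameter U \<le> \<delta>))"

text \<open>Intended for bounded subsets of Euclidean space.
  As \<open>ln 0 = 0\<close>, the empty set has dimension \<open>0\<close>.\<close>

definition lower_box_dim :: "'a::metric_space set \<Rightarrow> ereal" where
  "lower_box_dim F =
     Liminf (at_right 0) (\<lambda>\<delta>. ereal (ln (real (covering_number \<delta> F)) / - ln \<delta>))"

definition level_set :: "'a set \<Rightarrow> ('a \<Rightarrow> real) \<Rightarrow> real \<Rightarrow> 'a set" where
  "level_set F f r = {x \<in> F. f x = r}"

definition holder1_on :: "real \<Rightarrow> 'a::metric_space set \<Rightarrow> ('a \<Rightarrow> real) \<Rightarrow> bool" where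
  "holder1_on \<alpha> F f \<longleftrightarrow> (\<forall>a\<in>F. \<forall>b\<in>F. \<bar>f a - f b\<bar> \<le> dist a b powr \<alpha>)"

text \<open>Functions on \<open>F\<close> are represented by their extensional versions; the topology on
  the 1-Hoelder-\<open>\<alpha>\<close> functions is the one induced by the supremum metric of
  \<^const>\<open>cfunspace\<close> on the continuous bounded functions.\<close>

definition holder1_space :: "real \<Rightarrow> 'a::metric_space set \<Rightarrow> ('a \<Rightarrow> real) topology" where
  "holder1_space \<alpha> F =
     subtopology (mtopology_of (cfunspace (top_of_set F) euclidean_metric))
                 {f. holder1_on \<alpha> F f}"

definition dense_gdeltas :: "real \<Rightarrow> 'a::metric_space set \<Rightarrow> ('a \<Rightarrow> real) set set" where
  "dense_gdeltas \<alpha> F =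
     {G. gdelta_in (holder1_space \<alpha> F) G \<and>
         holder1_space \<alpha> F closure_of G = topspace (holder1_space \<alpha> F)}"

definition D_lower_box_fun :: "('a::metric_space \<Rightarrow> real) \<Rightarrow> 'a set \<Rightarrow> ereal" where
  "D_lower_box_fun f F =
     Sup {ereal d | d. emeasure lebesgue {r. lower_box_dim (level_set F f r) \<ge> ereal d} > 0}"

definition D_lower_box :: "real \<Rightarrow> 'a::metric_space set \<Rightarrow> ereal" where
  "D_lower_box \<alpha> F = (SUP G\<in>dense_gdeltas \<alpha> F. INF f\<in>G. D_lower_box_fun f F)"

definition h_B :: "real \<Rightarrow> real" where
  "h_B d = ((1 - d) * ln (1 - d) - d * ln d - (1 - 2 * d) * ln (1 - 2 * d) + d * ln 3) / ln 2"

definition h_B_inv :: "real \<Rightarrow> real" where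
  "h_B_inv = the_inv_into {0<..1/3} h_B"

end

theory Submission
  imports Defs "HOL-Real_Asymp.Real_Asymp"
begin

text \<open>
  Call a triangle crossed by \<open>r\<close> if some vertex value of \<open>f\<close> is below \<open>r\<close> and some is not; then
  exactly one vertex is alone on its side. By continuity every crossed triangle meets the level set
  of \<open>r\<close>, so it suffices to bound from below the number \<open>N\<^sub>n(r)\<close> of crossed triangles of level \<open>n\<close>.
  If a crossed triangle has only one crossed child, this child lies at the lone vertex, which stays
  alone; otherwise at least two children are crossed. With \<open>y = 2\<^sup>-\<^sup>t\<close>, convexity gives
  \<open>(N + N')\<^sup>-\<^sup>t \<le> (y/2) (N\<^sup>-\<^sup>t + N'\<^sup>-\<^sup>t)\<close>. Let \<open>j\<^sub>n\<close> be the largest possible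
  integral of \<open>N\<^sub>n\<^sup>-\<^sup>t\<close> over the \<open>r\<close> that cross a given triangle, and \<open>u\<^sub>n\<close> the largest one over
  the \<open>r\<close> that make a given vertex lone. Then
  \<open>u\<^sub>n\<^sub>+\<^sub>1 \<le> (1 - y/2) u\<^sub>n + (3y/2) j\<^sub>n\<close> and \<open>j\<^sub>n\<^sub>+\<^sub>1 \<le> (2 - y) u\<^sub>n + (3y/2) j\<^sub>n\<close>,
  so both grow at most like \<open>x\<^sup>n\<close> where \<open>x\<^sup>2 = x + 3y\<close>, as long as \<open>x \<le> 2\<close>. The starting values
  are at most \<open>2\<^sup>-\<^sup>\<alpha>\<^sup>n\<close> by the Hoelder condition. For \<open>x = (1 - d) / (1 - 2d)\<close> one has
  \<open>x y\<^sup>-\<^sup>d = 2\<^sup>h\<close> with \<open>h = h_B d\<close>, so for \<open>h_B d < \<alpha>\<close> the integral of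
  \<open>\<Sum>\<^sub>n y\<^sup>-\<^sup>d\<^sup>n N\<^sub>n(r)\<^sup>-\<^sup>t\<close> is finite, and almost every \<open>r\<close> that crosses the triangle satisfies
  \<open>N\<^sub>n(r) \<ge> 2\<^sup>d\<^sup>n\<close> eventually. An \<open>r\<close> in the range that crosses no triangle of any level is the
  minimum or the maximum of \<open>f\<close>.

  The nonconstant functions form a dense open set, and for them the range has positive measure.
\<close>

subsection \<open>Crossed triangles\<close>

text \<open>Only descendants all of whose ancestors are crossed are counted. Such an undercount is
  harmless where lower bounds are wanted, and it makes positivity independent of the depth. A vertex
  value equal to \<open>r\<close> counts as lying above.\<close>

fun crossings :: "('a::real_vector \<Rightarrow> real) \<Rightarrow> real \<Rightarrow> nat \<Rightarrow> 'a \<times> 'a \<times> 'a \<Rightarrow> nat" where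
  "crossings f r 0 (p, q, s) = of_bool ((f p < r) \<noteq> (f q < r) \<or> (f q < r) \<noteq> (f s < r))"
| "crossings f r (Suc n) (p, q, s) =
     (if (f p < r) \<noteq> (f q < r) \<or> (f q < r) \<noteq> (f s < r)
      then crossings f r n (p, midpoint p q, midpoint p s)
         + crossings f r n (midpoint p q, q, midpoint q s)
         + crossings f r n (midpoint p s, midpoint q s, s)
      else 0)"

definition lone :: "('a \<Rightarrow> real) \<Rightarrow> real \<Rightarrow> 'a \<Rightarrow> 'a \<Rightarrow> 'a \<Rightarrow> bool" where
  "lone f r p q s \<longleftrightarrow> (f p < r) \<noteq> (f q < r) \<and> (f p < r) \<noteq> (f s < r)"

text \<open>Were no child crossed, all vertices and midpoints would lie on one side, because any two
  children share a midpoint. Hence a crossed triangle has crossed descendants at every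
  depth.\<close>

lemma crossings_pos_iff:
  "crossings f r n (p, q, s) > 0 \<longleftrightarrow> (f p < r) \<noteq> (f q < r) \<or> (f q < r) \<noteq> (f s < r)"
proof (induction n arbitrary: p q s)
  case 0
  then show ?case by simp
next
  case (Suc n)
  show ?case
    unfolding crossings.simps by (auto simp: Suc.IH)
qed

lemma crossings_Suc_ge:
  assumes "crossings f r (Suc n) (p, q, s) > 0"
  shows "crossings f r (Suc n) (p, q, s)
         = crossings f r n (p, midpoint p q, midpoint p s)
         + crossings f r n (midpoint p q, q, midpoint q s)
         + crossings f r n (midpoint p s, midpoint q s, s)"
  using assms by (auto split: if_splits)

lemma lone_crossings_pos:
  assumes "lone f r p q s \<or> lone f r q p s \<or> lone f r s p q"
  shows "crossings f r n (p, q, s) > 0"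
  using assms by (auto simp: crossings_pos_iff lone_def)

lemma crossings_pos_lone:
  assumes "crossings f r n (p, q, s) > 0"
  shows "lone f r p q s \<or> lone f r q p s \<or> lone f r s p q"
  using assms by (auto simp: crossings_pos_iff lone_def)

text \<open>The arithmetic-geometric mean inequality is applied twice, to \<open>u\<close> and
  \<open>v\<close> and to their powers. This is what turns two crossed children into the factor
  \<open>y / 2\<close>.\<close>

lemma powr_add_le_mean:
  fixes s u v w :: real
  assumes "s > 0" "u > 0" "v > 0" "u + v \<le> w"
  shows "w powr (-s) \<le> (2 powr (-s) / 2) * (u powr (-s) + v powr (-s))"
proof -
  have am: "2 * sqrt (u * v) \<le> u + v"
    using arith_geo_mean_sqrt[of u v] assms by simp
  have "w powr (-s) \<le> (2 * sqrt (u * v)) powr (-s)"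
    using assms am by (intro powr_mono2') auto
  also have "\<dots> = 2 powr (-s) * sqrt ((u powr (-s)) * (v powr (-s)))"
    using assms by (simp add: powr_mult real_sqrt_mult powr_half_sqrt[symmetric] powr_powr mult.commute)
  also have "\<dots> \<le> 2 powr (-s) * ((u powr (-s) + v powr (-s)) / 2)"
    using arith_geo_mean_sqrt[of "u powr (-s)" "v powr (-s)"] by (intro mult_left_mono) auto
  finally show ?thesis by simp
qed

text \<open>The regularity of \<open>f\<close> enters the integral estimates in this form alone: a
  bound on the oscillation over the vertices of each descendant at the final depth.\<close>

fun increments_le :: "('a::real_vector \<Rightarrow> real) \<Rightarrow> real \<Rightarrow> nat \<Rightarrow> 'a \<times> 'a \<times> 'a \<Rightarrow> bool" where
  "increments_le f l 0 (p, q, s) \<longleftrightarrow> \<bar>f p - f q\<bar> \<le> l \<and> \<bar>f p - f s\<bar> \<le> l \<and> \<bar>f q - f s\<bar> \<le> l"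
| "increments_le f l (Suc n) (p, q, s) \<longleftrightarrow>
     increments_le f l n (p, midpoint p q, midpoint p s) \<and>
     increments_le f l n (midpoint p q, q, midpoint q s) \<and>
     increments_le f l n (midpoint p s, midpoint q s, s)"

text \<open>The common shape of both recursions: \<open>g1\<close>, \<open>g2\<close> stand for lone
  weights of corner children, \<open>h1\<close>, \<open>h2\<close>, \<open>h3\<close> for the
  weights of all children. Taking \<open>g2\<close> to be zero gives the recursion for a prescribed
  lone vertex.\<close>

lemma nn_integral_five_le:
  fixes F g1 g2 h1 h2 h3 :: "real \<Rightarrow> real" and c d G1 G2 H :: real
  assumes [measurable]: "g1 \<in> borel_measurable borel" "g2 \<in> borel_measurable borel"
      "h1 \<in> borel_measurable borel" "h2 \<in> borel_measurable borel" "h3 \<in> borel_measurable borel"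
    and nn: "\<And>r. g1 r \<ge> 0" "\<And>r. g2 r \<ge> 0" "\<And>r. h1 r \<ge> 0" "\<And>r. h2 r \<ge> 0" "\<And>r. h3 r \<ge> 0"
    and c: "c \<ge> 0" and d: "d \<ge> 0" and "G1 \<ge> 0" "G2 \<ge> 0" "H \<ge> 0"
    and F: "\<And>r. F r \<le> c * (g1 r + g2 r) + d * (h1 r + h2 r + h3 r)"
    and g1: "(\<integral>\<^sup>+r. ennreal (g1 r) \<partial>lborel) \<le> ennreal G1"
    and g2: "(\<integral>\<^sup>+r. ennreal (g2 r) \<partial>lborel) \<le> ennreal G2"
    and h1: "(\<integral>\<^sup>+r. ennreal (h1 r) \<partial>lborel) \<le> ennreal H"
    and h2: "(\<integral>\<^sup>+r. ennreal (h2 r) \<partial>lborel) \<le> ennreal H"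
    and h3: "(\<integral>\<^sup>+r. ennreal (h3 r) \<partial>lborel) \<le> ennreal H"
  shows "(\<integral>\<^sup>+r. ennreal (F r) \<partial>lborel) \<le> ennreal (c * (G1 + G2) + 3 * d * H)"
proof -
  have "(\<integral>\<^sup>+r. ennreal (F r) \<partial>lborel)
     \<le> (\<integral>\<^sup>+r. ennreal c * (ennreal (g1 r) + ennreal (g2 r))
          + ennreal d * (ennreal (h1 r) + ennreal (h2 r) + ennreal (h3 r)) \<partial>lborel)"
  proof (intro nn_integral_mono)
    fix r
    have "ennreal (F r) \<le> ennreal (c * (g1 r + g2 r) + d * (h1 r + h2 r + h3 r))"
      by (intro ennreal_leI F)
    also have "\<dots> = ennreal c * (ennreal (g1 r) + ennreal (g2 r))
          + ennreal d * (ennreal (h1 r) + ennreal (h2 r) + ennreal (h3 r))"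
      using nn c d by (simp add: ennreal_mult)
    finally show "ennreal (F r) \<le> \<dots>" .
  qed
  also have "\<dots> = ennreal c * ((\<integral>\<^sup>+r. ennreal (g1 r) \<partial>lborel) + (\<integral>\<^sup>+r. ennreal (g2 r) \<partial>lborel))
      + ennreal d * ((\<integral>\<^sup>+r. ennreal (h1 r) \<partial>lborel) + (\<integral>\<^sup>+r. ennreal (h2 r) \<partial>lborel)
         + (\<integral>\<^sup>+r. ennreal (h3 r) \<partial>lborel))"
    by (simp add: nn_integral_add nn_integral_cmult)
  also have "\<dots> \<le> ennreal c * (ennreal G1 + ennreal G2) + ennreal d * (ennreal H + ennreal H + ennreal H)"
    by (intro add_mono mult_left_mono g1 g2 h1 h2 h3) auto
  also have "\<dots> = ennreal (c * (G1 + G2) + d * (H + H + H))"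
    by (simp only: ennreal_mult ennreal_plus add_nonneg_nonneg mult_nonneg_nonneg c d
        \<open>G1 \<ge> 0\<close> \<open>G2 \<ge> 0\<close> \<open>H \<ge> 0\<close>)
  finally show ?thesis by (simp add: algebra_simps)
qed

section \<open>Recursion for the integrated negative moments of the counts\<close>

locale crossing_weight =
  fixes f :: "'a::real_vector \<Rightarrow> real" and t y :: real
  assumes t: "t > 0" and y: "y = 2 powr (-t)"
begin

text \<open>Since \<open>0 powr (-t) = 0\<close>, the weight vanishes at every \<open>r\<close> that
  does not cross \<open>T\<close>, so an integral over the whole line sees the crossing levels
  only.\<close>

definition weight :: "nat \<Rightarrow> 'a \<times> 'a \<times> 'a \<Rightarrow> real \<Rightarrow> real" where
  "weight n T r = real (crossings f r n T) powr (-t)"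

lemma weight_nonneg: "weight n T r \<ge> 0"
  by (simp add: weight_def)

text \<open>The default value \<open>0 powr (-t) = 0\<close> breaks monotonicity at zero, hence the
  positivity of the smaller count.\<close>

lemma weight_antimono:
  assumes "0 < crossings f r m T" "crossings f r m T \<le> crossings f r n S"
  shows "weight n S r \<le> weight m T r"
  unfolding weight_def using assms t by (intro powr_mono2') auto

lemma weight_branch:
  assumes "0 < crossings f r m T" "0 < crossings f r m S"
    and "crossings f r m T + crossings f r m S \<le> crossings f r n R"
  shows "weight n R r \<le> y / 2 * (weight m T r + weight m S r)"
  unfolding weight_def y using assms t
  by (intro powr_add_le_mean) (auto simp flip: of_nat_add)

lemma y01: "0 < y" "y < 1"
  using t by (auto simp: y powr_less_one)

text \<open>If the corner child does not inherit the lone vertex, then at least two children are crossed.\<close>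

lemma weight_step:
  fixes p q s :: 'a
  defines "A \<equiv> (p, midpoint p q, midpoint p s)"
    and "B \<equiv> (midpoint p q, q, midpoint q s)"
    and "C \<equiv> (midpoint p s, midpoint q s, s)"
  defines "S \<equiv> \<lambda>n r. y / 2 * (weight n A r + weight n B r + weight n C r)"
  shows "lone f r p q s \<Longrightarrow> weight (Suc n) (p, q, s) r
      \<le> (1 - y / 2) * (of_bool (lone f r p (midpoint p q) (midpoint p s)) * weight n A r) + S n r"
    and "lone f r q p s \<Longrightarrow> weight (Suc n) (p, q, s) r
      \<le> (1 - y / 2) * (of_bool (lone f r q (midpoint p q) (midpoint q s)) * weight n B r) + S n r"
    and "lone f r s p q \<Longrightarrow> weight (Suc n) (p, q, s) r
      \<le> (1 - y / 2) * (of_bool (lone f r s (midpoint p s) (midpoint q s)) * weight n C r) + S n r"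
proof -
  let ?c = "\<lambda>T. crossings f r n T"
  have nn: "y / 2 * weight n A r \<ge> 0" "y / 2 * weight n B r \<ge> 0" "y / 2 * weight n C r \<ge> 0"
    using y01 by (auto simp: weight_nonneg)
  have S_eq: "S n r = y / 2 * weight n A r + y / 2 * weight n B r + y / 2 * weight n C r"
    by (simp add: S_def algebra_simps)
  have two: "weight (Suc n) (p, q, s) r \<le> S n r"
    if "crossings f r (Suc n) (p, q, s) > 0"
      and "?c A > 0 \<and> ?c B > 0 \<or> ?c A > 0 \<and> ?c C > 0 \<or> ?c B > 0 \<and> ?c C > 0"
  proof -
    have "crossings f r (Suc n) (p, q, s) = ?c A + ?c B + ?c C"
      using crossings_Suc_ge[OF that(1)] by (simp add: A_def B_def C_def)
    then have ab: "?c A > 0 \<Longrightarrow> ?c B > 0 \<Longrightarrow> weight (Suc n) (p, q, s) r \<le> y / 2 * (weight n A r + weight n B r)"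
      and ac: "?c A > 0 \<Longrightarrow> ?c C > 0 \<Longrightarrow> weight (Suc n) (p, q, s) r \<le> y / 2 * (weight n A r + weight n C r)"
      and bc: "?c B > 0 \<Longrightarrow> ?c C > 0 \<Longrightarrow> weight (Suc n) (p, q, s) r \<le> y / 2 * (weight n B r + weight n C r)"
      by (intro weight_branch; simp)+
    show ?thesis
      using that(2) ab ac bc nn unfolding S_eq distrib_left by argo
  qed
  \<comment> \<open>Here \<open>1 = (1 - y / 2) + y / 2\<close>, and the second part of the weight
    of \<open>X\<close> is absorbed into \<open>S\<close>.\<close>
  have one: "weight (Suc n) (p, q, s) r \<le> (1 - y / 2) * (1 * weight n X r) + S n r"
    if "crossings f r (Suc n) (p, q, s) > 0" "?c X > 0" "X \<in> {A, B, C}" for X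
  proof -
    have "?c X \<le> crossings f r (Suc n) (p, q, s)"
      using crossings_Suc_ge[OF that(1)] that(3) by (auto simp: A_def B_def C_def)
    then have "weight (Suc n) (p, q, s) r \<le> weight n X r"
      by (rule weight_antimono[OF that(2)])
    moreover have "y / 2 * weight n X r \<le> S n r"
      using that(3) nn S_eq by auto
    ultimately show ?thesis by (simp add: algebra_simps)
  qed
  { assume l: "lone f r p q s"
    then have pos: "crossings f r (Suc n) (p, q, s) > 0" by (blast intro: lone_crossings_pos)
    show "weight (Suc n) (p, q, s) r
      \<le> (1 - y / 2) * (of_bool (lone f r p (midpoint p q) (midpoint p s)) * weight n A r) + S n r"
    proof (cases "lone f r p (midpoint p q) (midpoint p s)")
      case True
      then show ?thesis using one[OF pos, of A]
        by (auto simp: A_def intro!: lone_crossings_pos)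
    next
      case False
      \<comment> \<open>Some midpoint next to \<open>p\<close> lies on the side of \<open>p\<close>.
        If it is \<open>midpoint p q\<close>, then \<open>B\<close> is crossed, and so is
        \<open>A\<close> or \<open>C\<close>, according to the side of
        \<open>midpoint p s\<close>.\<close>
      then have "?c A > 0 \<and> ?c B > 0 \<or> ?c A > 0 \<and> ?c C > 0 \<or> ?c B > 0 \<and> ?c C > 0"
        using l unfolding A_def B_def C_def crossings_pos_iff lone_def by blast
      then show ?thesis using two[OF pos] False by simp
    qed }
  { assume l: "lone f r q p s"
    then have pos: "crossings f r (Suc n) (p, q, s) > 0" by (blast intro: lone_crossings_pos)
    show "weight (Suc n) (p, q, s) r
      \<le> (1 - y / 2) * (of_bool (lone f r q (midpoint p q) (midpoint q s)) * weight n B r) + S n r"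
    proof (cases "lone f r q (midpoint p q) (midpoint q s)")
      case True
      then show ?thesis using one[OF pos, of B]
        by (auto simp: B_def intro!: lone_crossings_pos)
    next
      case False
      then have "?c A > 0 \<and> ?c B > 0 \<or> ?c A > 0 \<and> ?c C > 0 \<or> ?c B > 0 \<and> ?c C > 0"
        using l unfolding A_def B_def C_def crossings_pos_iff lone_def by blast
      then show ?thesis using two[OF pos] False by simp
    qed }
  { assume l: "lone f r s p q"
    then have pos: "crossings f r (Suc n) (p, q, s) > 0" by (blast intro: lone_crossings_pos)
    show "weight (Suc n) (p, q, s) r
      \<le> (1 - y / 2) * (of_bool (lone f r s (midpoint p s) (midpoint q s)) * weight n C r) + S n r"
    proof (cases "lone f r s (midpoint p s) (midpoint q s)")
      case True
      then show ?thesis using one[OF pos, of C]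
        by (auto simp: C_def intro!: lone_crossings_pos)
    next
      case False
      then have "?c A > 0 \<and> ?c B > 0 \<or> ?c A > 0 \<and> ?c C > 0 \<or> ?c B > 0 \<and> ?c C > 0"
        using l unfolding A_def B_def C_def crossings_pos_iff lone_def by blast
      then show ?thesis using two[OF pos] False by simp
    qed }
qed

lemma measurable_crossings:
  "(\<lambda>r. real (crossings f r n T)) \<in> borel_measurable borel"
proof (induction n arbitrary: T)
  case 0
  then show ?case
    by (cases T) (simp add: of_bool_def)
next
  case (Suc n)
  note [measurable] = Suc.IH
  obtain p q s where T: "T = (p, q, s)" by (cases T)
  show ?case unfolding T crossings.simps if_distrib of_nat_add by measurable
qed

lemma measurable_weight [measurable]: "weight n T \<in> borel_measurable borel"
  unfolding weight_def using measurable_crossings by measurable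

lemma measurable_lone [measurable]: "Measurable.pred borel (\<lambda>r. lone f r p q s)"
  unfolding lone_def by measurable

lemma nn_integral_weight_0:
  assumes "increments_le f l 0 (p, q, s)"
  shows "(\<integral>\<^sup>+r. ennreal (weight 0 (p, q, s) r) \<partial>lborel) \<le> ennreal l"
proof -
  let ?m = "min (f p) (min (f q) (f s))" and ?M = "max (f p) (max (f q) (f s))"
  have "ennreal (weight 0 (p, q, s) r) \<le> indicator {?m..?M} r" for r
    by (auto simp: weight_def indicator_def of_bool_def min_def max_def)
  then have "(\<integral>\<^sup>+r. ennreal (weight 0 (p, q, s) r) \<partial>lborel) \<le> (\<integral>\<^sup>+r. indicator {?m..?M} r \<partial>lborel)"
    by (intro nn_integral_mono)
  also have "\<dots> = ennreal (?M - ?m)"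
    by (simp add: min_def max_def)
  also have "\<dots> \<le> ennreal l"
    using assms by (intro ennreal_leI) auto
  finally show ?thesis .
qed

text \<open>The integrand behind \<open>u\<^sub>n\<close>; \<open>T\<close> is passed separately so
  that the triangle keeps its vertex order whichever vertex is lone.\<close>

definition lone_weight :: "'a \<Rightarrow> 'a \<Rightarrow> 'a \<Rightarrow> nat \<Rightarrow> 'a \<times> 'a \<times> 'a \<Rightarrow> real \<Rightarrow> real" where
  "lone_weight u v w n T r = (if lone f r u v w then weight n T r else 0)"

lemma lone_weight_nonneg: "lone_weight u v w n T r \<ge> 0"
  by (simp add: lone_weight_def weight_nonneg)

lemma lone_weight_le: "lone_weight u v w n T r \<le> weight n T r"
  by (simp add: lone_weight_def weight_nonneg)

lemma measurable_lone_weight [measurable]: "lone_weight u v w n T \<in> borel_measurable borel"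
  unfolding lone_weight_def by measurable

lemma weight_eq_0:
  assumes "\<not> lone f r p q s" "\<not> lone f r q p s" "\<not> lone f r s p q"
  shows "weight n (p, q, s) r = 0"
  using assms crossings_pos_lone[of f r n p q s] by (auto simp: weight_def)

text \<open>The median vertex is never the lone one, which is why at most two vertices contribute
  to the bound for the whole triangle.\<close>

lemma nn_integral_weight_le:
  assumes x: "1 < x" "x \<le> 2" and yx: "y = x * (x - 1) / 3" and "l \<ge> 0"
    and "increments_le f l n (p, q, s)"
  shows "(\<integral>\<^sup>+r. ennreal (weight n (p, q, s) r) \<partial>lborel) \<le> ennreal ((6 + x) / (3 * x) * x ^ n * l) \<and>
    (\<integral>\<^sup>+r. ennreal (lone_weight p q s n (p, q, s) r) \<partial>lborel) \<le> ennreal (x ^ n * l) \<and>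
    (\<integral>\<^sup>+r. ennreal (lone_weight q p s n (p, q, s) r) \<partial>lborel) \<le> ennreal (x ^ n * l) \<and>
    (\<integral>\<^sup>+r. ennreal (lone_weight s p q n (p, q, s) r) \<partial>lborel) \<le> ennreal (x ^ n * l)"
  using assms(5)
proof (induction n arbitrary: p q s)
  case 0
  have J: "(\<integral>\<^sup>+r. ennreal (weight 0 (p, q, s) r) \<partial>lborel) \<le> ennreal l"
    using nn_integral_weight_0[OF 0] .
  have L: "(\<integral>\<^sup>+r. ennreal (lone_weight u v w 0 (p, q, s) r) \<partial>lborel) \<le> ennreal l" for u v w
    by (rule order_trans[OF nn_integral_mono J]) (auto intro!: ennreal_leI lone_weight_le)
  have "1 \<le> (6 + x) / (3 * x)"
    using x by (simp add: field_simps)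
  then have "l \<le> (6 + x) / (3 * x) * l"
    using mult_right_mono[of 1 "(6 + x) / (3 * x)" l] \<open>l \<ge> 0\<close> by simp
  then have "ennreal l \<le> ennreal ((6 + x) / (3 * x) * l)"
    by (rule ennreal_leI)
  then show ?case
    using J L order_trans[OF J] by simp
next
  case (Suc n)
  define A where "A = (p, midpoint p q, midpoint p s)"
  define B where "B = (midpoint p q, q, midpoint q s)"
  define C where "C = (midpoint p s, midpoint q s, s)"
  let ?ga = "lone_weight p (midpoint p q) (midpoint p s) n A"
  let ?gb = "lone_weight q (midpoint p q) (midpoint q s) n B"
  let ?gc = "lone_weight s (midpoint p s) (midpoint q s) n C"
  define L where "L = x ^ n * l"
  \<comment> \<open>The factor \<open>(6 + x) / (3 * x)\<close> is the number \<open>k\<close> with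
    \<open>1 - y / 2 + (3 * y / 2) * k = x\<close>, so the bound for a lone vertex reproduces itself
    exactly.\<close>
  define J where "J = (6 + x) / (3 * x) * x ^ n * l"
  have LJ: "L \<ge> 0" "J \<ge> 0" using x \<open>l \<ge> 0\<close> by (auto simp: L_def J_def)
  have c: "1 - y / 2 \<ge> 0" "y / 2 \<ge> 0" using y01 by auto
  have incr: "increments_le f l n A" "increments_le f l n B" "increments_le f l n C"
    using Suc.prems by (auto simp: A_def B_def C_def)
  note IH = Suc.IH[OF incr(1)[unfolded A_def], folded A_def]
    Suc.IH[OF incr(2)[unfolded B_def], folded B_def]
    Suc.IH[OF incr(3)[unfolded C_def], folded C_def]
  have IHJ: "(\<integral>\<^sup>+r. ennreal (weight n A r) \<partial>lborel) \<le> ennreal J"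
    "(\<integral>\<^sup>+r. ennreal (weight n B r) \<partial>lborel) \<le> ennreal J"
    "(\<integral>\<^sup>+r. ennreal (weight n C r) \<partial>lborel) \<le> ennreal J"
    using IH by (auto simp: J_def)
  have IHL: "(\<integral>\<^sup>+r. ennreal (?ga r) \<partial>lborel) \<le> ennreal L"
    "(\<integral>\<^sup>+r. ennreal (?gb r) \<partial>lborel) \<le> ennreal L"
    "(\<integral>\<^sup>+r. ennreal (?gc r) \<partial>lborel) \<le> ennreal L"
    using IH by (auto simp: L_def)
  let ?S = "\<lambda>r. y / 2 * (weight n A r + weight n B r + weight n C r)"
  have wa: "weight (Suc n) (p, q, s) r \<le> (1 - y / 2) * ?ga r + ?S r" if "lone f r p q s" for r
    using weight_step(1)[OF that, of n] by (auto simp: lone_weight_def A_def B_def C_def)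
  have wb: "weight (Suc n) (p, q, s) r \<le> (1 - y / 2) * ?gb r + ?S r" if "lone f r q p s" for r
    using weight_step(2)[OF that, of n] by (auto simp: lone_weight_def A_def B_def C_def)
  have wc: "weight (Suc n) (p, q, s) r \<le> (1 - y / 2) * ?gc r + ?S r" if "lone f r s p q" for r
    using weight_step(3)[OF that, of n] by (auto simp: lone_weight_def A_def B_def C_def)
  note nn = lone_weight_nonneg weight_nonneg
  have S_nn: "?S r \<ge> 0" for r
    using c by (auto intro!: mult_nonneg_nonneg add_nonneg_nonneg nn)
  have one: "(\<integral>\<^sup>+r. ennreal (lone_weight u v w (Suc n) (p, q, s) r) \<partial>lborel) \<le> ennreal (x ^ Suc n * l)"
    if g: "g \<in> borel_measurable borel" "\<And>r. g r \<ge> 0" "(\<integral>\<^sup>+r. ennreal (g r) \<partial>lborel) \<le> ennreal L"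
      and w: "\<And>r. lone f r u v w \<Longrightarrow> weight (Suc n) (p, q, s) r \<le> (1 - y / 2) * g r + ?S r"
    for g :: "real \<Rightarrow> real" and u v w
  proof -
    have "(\<integral>\<^sup>+r. ennreal (lone_weight u v w (Suc n) (p, q, s) r) \<partial>lborel)
        \<le> ennreal ((1 - y / 2) * (L + 0) + 3 * (y / 2) * J)"
    proof (rule nn_integral_five_le[of g "\<lambda>r. 0" "weight n A" "weight n B" "weight n C"])
      fix r
      show "lone_weight u v w (Suc n) (p, q, s) r \<le> (1 - y / 2) * (g r + 0) + ?S r"
        using w[of r] S_nn[of r] mult_nonneg_nonneg[OF c(1) g(2)[of r]]
        by (auto simp: lone_weight_def)
    qed (use g IHJ LJ c nn in auto)
    also have "(1 - y / 2) * (L + 0) + 3 * (y / 2) * J = x ^ Suc n * l"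
      using x by (simp add: yx L_def J_def field_simps)
    finally show ?thesis .
  qed
  have two: "(\<integral>\<^sup>+r. ennreal (weight (Suc n) (p, q, s) r) \<partial>lborel) \<le> ennreal ((6 + x) / (3 * x) * x ^ Suc n * l)"
    if g: "g \<in> borel_measurable borel" "\<And>r. g r \<ge> 0" "(\<integral>\<^sup>+r. ennreal (g r) \<partial>lborel) \<le> ennreal L"
      and h: "h \<in> borel_measurable borel" "\<And>r. h r \<ge> 0" "(\<integral>\<^sup>+r. ennreal (h r) \<partial>lborel) \<le> ennreal L"
      and w: "\<And>r. weight (Suc n) (p, q, s) r > 0 \<Longrightarrow>
          weight (Suc n) (p, q, s) r \<le> (1 - y / 2) * g r + ?S r \<or>
          weight (Suc n) (p, q, s) r \<le> (1 - y / 2) * h r + ?S r"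
    for g h :: "real \<Rightarrow> real"
  proof -
    have "(\<integral>\<^sup>+r. ennreal (weight (Suc n) (p, q, s) r) \<partial>lborel)
        \<le> ennreal ((1 - y / 2) * (L + L) + 3 * (y / 2) * J)"
    proof (rule nn_integral_five_le[of g h "weight n A" "weight n B" "weight n C"])
      fix r
      show "weight (Suc n) (p, q, s) r \<le> (1 - y / 2) * (g r + h r) + ?S r"
        using w[of r] S_nn[of r] mult_nonneg_nonneg[OF c(1) g(2)[of r]]
          mult_nonneg_nonneg[OF c(1) h(2)[of r]] unfolding distrib_left[of "1 - y / 2"]
        by linarith
    qed (use g h IHJ LJ c nn in auto)
    also have "(1 - y / 2) * (L + L) + 3 * (y / 2) * J \<le> (6 + x) / (3 * x) * x ^ Suc n * l"
    proof -
      have e: "3 * (y / 2) * J = (x - 1) * (6 + x) / 6 * L"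
        using x by (simp add: yx L_def J_def field_simps)
      \<comment> \<open>Up to the factor \<open>L\<close>, the recursion for the whole triangle
        closes exactly when this product is nonnegative, hence the bound
        \<open>x \<le> 2\<close>.\<close>
      have "(2 - x) * (3 - x) \<ge> 0" using x by simp
      then have "(2 - y) + (x - 1) * (6 + x) / 6 \<le> (6 + x) / 3"
        by (simp add: yx field_simps)
      then have "((2 - y) + (x - 1) * (6 + x) / 6) * L \<le> (6 + x) / 3 * L"
        by (rule mult_right_mono[OF _ LJ(1)])
      also have "(6 + x) / 3 * L = (6 + x) / (3 * x) * x ^ Suc n * l"
        using x by (simp add: L_def field_simps)
      finally show ?thesis unfolding e by (simp add: algebra_simps)
    qed
    then have "ennreal ((1 - y / 2) * (L + L) + 3 * (y / 2) * J) \<le> ennreal ((6 + x) / (3 * x) * x ^ Suc n * l)"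
      by (rule ennreal_leI)
    finally show ?thesis .
  qed
  have pos: "lone f r p q s \<or> lone f r q p s \<or> lone f r s p q" if "weight (Suc n) (p, q, s) r > 0" for r
    using weight_eq_0[of r p q s "Suc n"] that by fastforce
  \<comment> \<open>The median depends only on the vertex values, so one vertex is excluded for all
    \<open>r\<close> simultaneously and two lone weights suffice.\<close>
  consider "\<And>r. \<not> lone f r p q s" | "\<And>r. \<not> lone f r q p s" | "\<And>r. \<not> lone f r s p q"
  proof -
    have "(\<forall>r. \<not> lone f r p q s) \<or> (\<forall>r. \<not> lone f r q p s) \<or> (\<forall>r. \<not> lone f r s p q)"
      unfolding lone_def by (smt (verit, best))
    then show ?thesis using that by blast
  qed
  then have "(\<integral>\<^sup>+r. ennreal (weight (Suc n) (p, q, s) r) \<partial>lborel) \<le> ennreal ((6 + x) / (3 * x) * x ^ Suc n * l)"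
  proof cases
    case 1
    show ?thesis by (rule two[of ?gb ?gc]) (use pos 1 wb wc IHL nn in \<open>auto | blast\<close>)
  next
    case 2
    show ?thesis by (rule two[of ?ga ?gc]) (use pos 2 wa wc IHL nn in \<open>auto | blast\<close>)
  next
    case 3
    show ?thesis by (rule two[of ?ga ?gb]) (use pos 3 wa wb IHL nn in \<open>auto | blast\<close>)
  qed
  moreover have "(\<integral>\<^sup>+r. ennreal (lone_weight p q s (Suc n) (p, q, s) r) \<partial>lborel) \<le> ennreal (x ^ Suc n * l)"
    by (rule one[of ?ga]) (use wa IHL nn in auto)
  moreover have "(\<integral>\<^sup>+r. ennreal (lone_weight q p s (Suc n) (p, q, s) r) \<partial>lborel) \<le> ennreal (x ^ Suc n * l)"
    by (rule one[of ?gb]) (use wb IHL nn in auto)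
  moreover have "(\<integral>\<^sup>+r. ennreal (lone_weight s p q (Suc n) (p, q, s) r) \<partial>lborel) \<le> ennreal (x ^ Suc n * l)"
    by (rule one[of ?gc]) (use wc IHL nn in auto)
  ultimately show ?case by blast
qed

end

subsection \<open>Almost every level is crossed often\<close>

text \<open>This \<open>x\<close> minimises \<open>ln x - d * ln y\<close> over
  \<open>x > 1\<close>, where \<open>y = x * (x - 1) / 3\<close>; thus \<open>h_B d * ln 2\<close>
  is the smallest growth rate that the recursion yields for \<open>d\<close>. The identity itself
  follows by taking logarithms.\<close>

lemma h_B_eq_powr:
  fixes d x y :: real
  assumes d: "0 < d" "d \<le> 1/3" and x: "x = (1 - d) / (1 - 2 * d)" and y: "y = x * (x - 1) / 3"
  shows "x * y powr (-d) = 2 powr h_B d"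
proof -
  have x1: "x - 1 = d / (1 - 2 * d)" using d by (simp add: x field_simps)
  have pos: "x > 0" "x - 1 > 0" "y > 0" using d by (auto simp: x1 y) (auto simp: x)
  have lx: "ln x = ln (1 - d) - ln (1 - 2 * d)" using d by (simp add: x ln_div)
  have "ln (x - 1) = ln d - ln (1 - 2 * d)" using d by (simp add: x1 ln_div)
  then have ly: "ln y = ln (1 - d) + ln d - 2 * ln (1 - 2 * d) - ln 3"
    using pos by (simp add: y ln_div ln_mult lx)
  have "h_B d * ln 2 = (1 - d) * ln (1 - d) - d * ln d - (1 - 2 * d) * ln (1 - 2 * d) + d * ln 3"
    by (simp add: h_B_def)
  then have "ln (x * y powr (-d)) = ln (2 powr h_B d)"
    using pos by (simp add: ln_mult ln_powr lx ly algebra_simps)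
  then show ?thesis using pos by (subst (asm) ln_inj_iff) auto
qed

lemma strict_mono_on_h_B: "strict_mono_on {0<..1/3} h_B"
proof (rule strict_mono_onI)
  fix u v :: real
  assume uv: "u \<in> {0<..1/3}" "v \<in> {0<..1/3}" "u < v"
  show "h_B u < h_B v"
  proof (rule DERIV_pos_imp_increasing[OF uv(3)])
    fix d assume d: "u \<le> d" "d \<le> v"
    then have dd: "0 < d" "d \<le> 1/3" using uv by auto
    \<comment> \<open>With \<open>y = d * (1 - d) / (3 * (1 - 2 * d)\<^sup>2)\<close>, as in the
      recursion, this derivative is \<open>- ln y / ln 2\<close>, so its positivity means
      \<open>y < 1\<close>.\<close>
    let ?D = "(- ln (1 - d) - ln d + 2 * ln (1 - 2 * d) + ln 3) / ln 2"
    have "(h_B has_real_derivative ?D) (at d)"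
    proof -
      have e: "((\<lambda>x. x * ln x) has_real_derivative ln z + 1) (at z)" if "z > 0" for z :: real
        using that by (auto intro!: derivative_eq_intros)
      have e1: "((\<lambda>d. (1 - d) * ln (1 - d)) has_real_derivative (ln (1 - d) + 1) * (-1)) (at d)"
        by (rule DERIV_chain2[OF e]) (use dd in \<open>auto intro!: derivative_eq_intros\<close>)
      have e2: "((\<lambda>d. (1 - 2 * d) * ln (1 - 2 * d)) has_real_derivative (ln (1 - 2 * d) + 1) * (-2)) (at d)"
        by (rule DERIV_chain2[OF e]) (use dd in \<open>auto intro!: derivative_eq_intros\<close>)
      show ?thesis
        unfolding h_B_def[abs_def]
        by (rule DERIV_cong[OF DERIV_cdivide[OF DERIV_add[OF DERIV_diff[OF DERIV_diff[OF e1 e[OF dd(1)]] e2]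
              DERIV_cmult_right[OF DERIV_ident]]]]) (simp add: algebra_simps)
    qed
    moreover have "?D > 0"
    proof -
      have "d * (1 - d) < 3 * (1 - 2 * d)\<^sup>2"
      proof -
        \<comment> \<open>Expansion about \<open>d = 1/3\<close>, in which every term is nonnegative
          for \<open>d \<le> 1/3\<close>.\<close>
        have "3 * (1 - 2 * d)\<^sup>2 - d * (1 - d) = 13 * (1/3 - d)\<^sup>2 + 13 / 3 * (1/3 - d) + 1/9"
          by (simp add: power2_eq_square field_simps)
        also have "\<dots> > 0" using dd by (intro add_nonneg_pos add_nonneg_nonneg) auto
        finally show ?thesis by simp
      qed
      then have "ln (d * (1 - d)) < ln (3 * (1 - 2 * d)\<^sup>2)"
        using dd by (subst ln_less_cancel_iff) auto
      then have "ln d + ln (1 - d) < ln 3 + 2 * ln (1 - 2 * d)"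
        using dd by (simp add: ln_mult ln_realpow del: right_diff_distrib)
      then show ?thesis by simp
    qed
    ultimately show "\<exists>D. (h_B has_real_derivative D) (at d) \<and> D > 0" by blast
  qed
qed

text \<open>\<open>the_inv_into\<close> is specified only on the image, so \<open>\<alpha>\<close>
  has to be shown to be a value: \<open>h_B\<close> tends to \<open>0\<close> at \<open>0\<close>
  and equals \<open>ln 12 / (3 * ln 2) > 1\<close> at \<open>1/3\<close>.\<close>

lemma h_B_inv:
  assumes "0 < \<alpha>" "\<alpha> \<le> 1"
  shows "h_B_inv \<alpha> \<in> {0<..1/3}" "h_B (h_B_inv \<alpha>) = \<alpha>"
proof -
  have "(h_B \<longlongrightarrow> 0) (at_right 0)"
    unfolding h_B_def[abs_def] by real_asymp
  then have "eventually (\<lambda>d. h_B d < \<alpha>) (at_right 0)"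
    using assms(1) order_tendstoD(2) by blast
  moreover have "eventually (\<lambda>d::real. d \<in> {0<..<1/3}) (at_right 0)"
    using eventually_at_right_real[of 0 "1/3 :: real"] by simp
  ultimately have "eventually (\<lambda>d. h_B d < \<alpha> \<and> d \<in> {0<..<1/3}) (at_right 0)"
    by eventually_elim auto
  then obtain e where e: "h_B e < \<alpha>" "0 < e" "e < 1/3"
    using eventually_happens'[of "at_right (0::real)"] by fastforce
  have "h_B (1/3) = (2/3 * ln 2 + 1/3 * ln 3) / ln 2"
    by (simp add: h_B_def ln_div field_simps)
  also have "\<dots> \<ge> 1" by (simp add: field_simps)
  finally have h13: "h_B (1/3) \<ge> \<alpha>" using assms by simp
  have "continuous_on {e..1/3} h_B"
    unfolding h_B_def[abs_def] using e by (intro continuous_intros) auto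
  then obtain d where "e \<le> d" "d \<le> 1/3" "h_B d = \<alpha>"
    using IVT'[of h_B e \<alpha> "1/3"] e h13 by auto
  then have "\<alpha> \<in> h_B ` {0<..1/3}" using e by auto
  moreover have "inj_on h_B {0<..1/3}"
    by (rule strict_mono_on_imp_inj_on[OF strict_mono_on_h_B])
  ultimately show "h_B_inv \<alpha> \<in> {0<..1/3}" "h_B (h_B_inv \<alpha>) = \<alpha>"
    unfolding h_B_inv_def by (blast intro: the_inv_into_into f_the_inv_into_f)+
qed

text \<open>A Borel-Cantelli argument: the weighted negative moments of the counts have a finite sum
  of integrals, so almost everywhere the weighted terms tend to \<open>0\<close>. The constant
  \<open>C\<close> accommodates triangles of any starting level.\<close>

lemma AE_crossings_ge:
  fixes f :: "'a::real_vector \<Rightarrow> real" and d \<alpha> C :: real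
  assumes d: "0 < d" "d \<le> 1/3" and \<alpha>: "h_B d < \<alpha>" and "C \<ge> 0"
    and incr: "\<And>n. increments_le f (C * 2 powr (- \<alpha> * n)) n (p, q, s)"
  shows "AE r in lborel. crossings f r 0 (p, q, s) > 0 \<longrightarrow>
    (\<forall>\<^sub>F n in sequentially. 2 powr (d * n) \<le> real (crossings f r n (p, q, s)))"
proof -
  define x where "x = (1 - d) / (1 - 2 * d)"
  define y where "y = x * (x - 1) / 3"
  have x1: "x - 1 = d / (1 - 2 * d)" using d by (simp add: x_def field_simps)
  have "x - 1 > 0" using d by (simp add: x1)
  \<comment> \<open>This is the same as \<open>d \<le> 1/3\<close>; it gives
    \<open>y \<le> 2/3\<close>, hence a positive exponent \<open>t\<close>.\<close>
  moreover have "x \<le> 2" using d by (simp add: x_def field_simps)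
  ultimately have x: "1 < x" "x \<le> 2" by auto
  have ypos: "y > 0" using x by (simp add: y_def)
  have "x * (x - 1) \<le> 2 * 1" using x by (intro mult_mono) auto
  then have y1: "y < 1" by (simp add: y_def)
  define t where "t = - log 2 y"
  have t: "t > 0" using ypos y1 by (simp add: t_def)
  have y2: "y = 2 powr (-t)" using ypos by (simp add: t_def)
  interpret crossing_weight f t y by unfold_locales (fact t y2)+
  define \<rho> where "\<rho> = (6 + x) / (3 * x)"
  \<comment> \<open>The ratio of the dominating geometric series; it equals
    \<open>2 powr (h_B d - \<alpha>)\<close>.\<close>
  define z where "z = x * y powr (-d) * 2 powr (-\<alpha>)"
  have z: "0 < z" "z < 1"
  proof -
    show "0 < z" using x ypos by (simp add: z_def)
    have "z = 2 powr (h_B d - \<alpha>)"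
      unfolding z_def using h_B_eq_powr[OF d x_def y_def] by (simp add: powr_diff powr_minus_divide)
    also have "\<dots> < 1" using \<alpha> by (simp add: powr_less_one)
    finally show "z < 1" .
  qed
  have \<rho>: "\<rho> \<ge> 0" using x by (simp add: \<rho>_def)
  define g where "g n r = y powr (-d * n) * weight n (p, q, s) r" for n r
  have g_nonneg: "g n r \<ge> 0" for n r by (simp add: g_def weight_nonneg)
  have g_meas [measurable]: "g n \<in> borel_measurable borel" for n
    unfolding g_def by measurable
  have g_int: "(\<integral>\<^sup>+r. ennreal (g n r) \<partial>lborel) \<le> ennreal (\<rho> * C * z ^ n)" for n
  proof -
    have "(\<integral>\<^sup>+r. ennreal (g n r) \<partial>lborel)
        = ennreal (y powr (-d * n)) * (\<integral>\<^sup>+r. ennreal (weight n (p, q, s) r) \<partial>lborel)"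
      by (simp add: g_def ennreal_mult weight_nonneg nn_integral_cmult)
    also have "\<dots> \<le> ennreal (y powr (-d * n)) * ennreal (\<rho> * x ^ n * (C * 2 powr (- \<alpha> * n)))"
      using nn_integral_weight_le[OF x y_def _ incr] \<open>C \<ge> 0\<close>
      by (intro mult_left_mono) (auto simp: \<rho>_def)
    also have "\<dots> = ennreal (y powr (-d * n) * (\<rho> * x ^ n * (C * 2 powr (- \<alpha> * n))))"
      using \<rho> x \<open>C \<ge> 0\<close> by (subst ennreal_mult) auto
    also have "y powr (-d * n) * (\<rho> * x ^ n * (C * 2 powr (- \<alpha> * n))) = \<rho> * C * z ^ n"
      using ypos by (simp add: z_def power_mult_distrib powr_power mult_ac)
    finally show ?thesis .
  qed
  have "(\<integral>\<^sup>+r. (\<Sum>n. ennreal (g n r)) \<partial>lborel) = (\<Sum>n. \<integral>\<^sup>+r. ennreal (g n r) \<partial>lborel)"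
    by (rule nn_integral_suminf) measurable
  also have "\<dots> \<le> (\<Sum>n. ennreal (\<rho> * C * z ^ n))"
    by (intro suminf_le g_int) auto
  also have "\<dots> = ennreal (\<Sum>n. \<rho> * C * z ^ n)"
    using z \<rho> \<open>C \<ge> 0\<close> by (intro suminf_ennreal2) (auto intro!: summable_mult summable_geometric)
  finally have "(\<integral>\<^sup>+r. (\<Sum>n. ennreal (g n r)) \<partial>lborel) \<noteq> \<infinity>"
    by (auto simp: top_unique)
  then have "AE r in lborel. (\<Sum>n. ennreal (g n r)) \<noteq> \<infinity>"
    by (intro nn_integral_noteq_infinite) measurable
  then show ?thesis
  proof (rule eventually_mono, intro impI)
    fix r assume r: "(\<Sum>n. ennreal (g n r)) \<noteq> \<infinity>" and pos: "crossings f r 0 (p, q, s) > 0"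
    have "summable (\<lambda>n. g n r)"
      by (rule summable_suminf_not_top) (use r g_nonneg in auto)
    then have "(\<lambda>n. g n r) \<longlonglongrightarrow> 0" by (rule summable_LIMSEQ_zero)
    then have "\<forall>\<^sub>F n in sequentially. g n r < 1" by (rule order_tendstoD) simp
    then show "\<forall>\<^sub>F n in sequentially. 2 powr (d * n) \<le> real (crossings f r n (p, q, s))"
    proof eventually_elim
      case (elim n)
      let ?N = "real (crossings f r n (p, q, s))"
      have N: "?N > 0" using pos unfolding crossings_pos_iff of_nat_0_less_iff .
      \<comment> \<open>Because \<open>y = 2 powr (-t)\<close>, a term below \<open>1\<close> says
        that \<open>?N\<close> exceeds \<open>2 powr (d * n)\<close>.\<close>
      have "g n r = (2 powr (d * n) / ?N) powr t"
        using N by (simp add: g_def weight_def y2 powr_powr powr_divide powr_minus_divide mult_ac)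
      then have "(2 powr (d * n) / ?N) powr t \<le> 1" using elim by simp
      then have "2 powr (d * n) / ?N \<le> 1"
        using powr_less_mono2[OF t, of 1 "2 powr (d * n) / ?N"] by fastforce
      then show ?case using N by simp
    qed
  qed
qed

subsection \<open>The Sierpinski triangle in lattice coordinates\<close>

locale unit_triangle =
  fixes a b c :: "'a::euclidean_space"
  assumes dist_ab: "dist a b = 1" and dist_bc: "dist b c = 1" and dist_ac: "dist a c = 1"
begin

abbreviation "\<Delta> \<equiv> sierpinski a b c"

text \<open>Coordinates along two edges at scale \<open>2\<^sup>-\<^sup>n\<close> turn disjointness
  of descendants and the counting of neighbours into integer arithmetic.\<close>

definition vert :: "nat \<Rightarrow> nat \<Rightarrow> nat \<Rightarrow> 'a" where
  "vert n i j = a + (1/2) ^ n *\<^sub>R (real i *\<^sub>R (b - a) + real j *\<^sub>R (c - a))"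

text \<open>All index pairs are allowed, also those whose triangle does not occur in the
  construction; membership in \<open>step_triangles\<close> is therefore a separate
  hypothesis.\<close>

definition cell :: "nat \<Rightarrow> nat \<Rightarrow> nat \<Rightarrow> 'a \<times> 'a \<times> 'a" where
  "cell n i j = (vert n i j, vert n (Suc i) j, vert n i (Suc j))"

lemma midpoint_vert: "midpoint (vert n i j) (vert n k l) = vert (Suc n) (i + k) (j + l)"
proof -
  have "2 *\<^sub>R midpoint (vert n i j) (vert n k l) = 2 *\<^sub>R vert (Suc n) (i + k) (j + l)"
    by (simp add: midpoint_def vert_def algebra_simps scaleR_2)
  then show ?thesis by simp
qed

lemma vert_double: "vert (Suc n) (2 * i) (2 * j) = vert n i j"
  using midpoint_vert[of n i j i j] by (simp add: mult_2)

text \<open>Subdivision appends a binary digit to each index, so integer halving of the indices of a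
  child recovers the parent.\<close>

lemma cell_children:
  assumes "cell n i j = (p, q, s)"
  shows "(p, midpoint p q, midpoint p s) = cell (Suc n) (2 * i) (2 * j)"
    and "(midpoint p q, q, midpoint q s) = cell (Suc n) (Suc (2 * i)) (2 * j)"
    and "(midpoint p s, midpoint q s, s) = cell (Suc n) (2 * i) (Suc (2 * j))"
proof -
  have p: "p = vert n i j" "q = vert n (Suc i) j" "s = vert n i (Suc j)"
    using assms by (auto simp: cell_def)
  have p': "vert n i j = vert (Suc n) (2 * i) (2 * j)"
    "vert n (Suc i) j = vert (Suc n) (Suc (Suc (2 * i))) (2 * j)"
    "vert n i (Suc j) = vert (Suc n) (2 * i) (Suc (Suc (2 * j)))"
    using vert_double[of n i j] vert_double[of n "Suc i" j] vert_double[of n i "Suc j"] by auto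
  show "(p, midpoint p q, midpoint p s) = cell (Suc n) (2 * i) (2 * j)"
    and "(midpoint p q, q, midpoint q s) = cell (Suc n) (Suc (2 * i)) (2 * j)"
    and "(midpoint p s, midpoint q s, s) = cell (Suc n) (2 * i) (Suc (2 * j))"
    unfolding p midpoint_vert cell_def by (auto simp: p' mult_2)
qed

lemma subdivide_cell:
  "subdivide (cell n i j) = {cell (Suc n) (2 * i) (2 * j), cell (Suc n) (Suc (2 * i)) (2 * j),
     cell (Suc n) (2 * i) (Suc (2 * j))}"
proof -
  obtain p q s where e: "cell n i j = (p, q, s)" by (metis prod_cases3)
  show ?thesis unfolding e subdivide.simps cell_children[OF e] ..
qed

lemma cell_0: "cell 0 0 0 = (a, b, c)"
  by (simp add: cell_def vert_def)

lemma step_triangles_cell: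
  assumes "T \<in> step_triangles a b c n"
  obtains i j where "T = cell n i j"
proof -
  have "\<exists>i j. T = cell n i j"
    using assms
  proof (induction n arbitrary: T)
    case 0
    then have "T = cell 0 0 0" by (simp add: cell_0)
    then show ?case by blast
  next
    case (Suc n)
    then obtain S where S: "S \<in> step_triangles a b c n" "T \<in> subdivide S" by auto
    with Suc.IH obtain i j where "S = cell n i j" by blast
    with S subdivide_cell show ?case by auto
  qed
  then show ?thesis using that by blast
qed

lemma step_triangles_child:
  assumes "T \<in> step_triangles a b c n" "S \<in> subdivide T"
  shows "S \<in> step_triangles a b c (Suc n)"
  using assms by auto

lemma cell_children_step:
  assumes "cell n i j \<in> step_triangles a b c n"
  shows "cell (Suc n) (2 * i) (2 * j) \<in> step_triangles a b c (Suc n)"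
    and "cell (Suc n) (Suc (2 * i)) (2 * j) \<in> step_triangles a b c (Suc n)"
    and "cell (Suc n) (2 * i) (Suc (2 * j)) \<in> step_triangles a b c (Suc n)"
  using step_triangles_child[OF assms] unfolding subdivide_cell by blast+

lemma dist_vert_sqr:
  "(dist (vert n i j) (vert n k l))\<^sup>2
     = ((1/2) ^ n)\<^sup>2 * ((real i - k)\<^sup>2 + (real i - k) * (real j - l) + (real j - l)\<^sup>2)"
proof -
  define u v where "u = b - a" and "v = c - a"
  define x y where "x = real i - k" and "y = real j - l"
  have uu: "u \<bullet> u = 1" using dist_ab by (simp add: u_def dist_norm norm_minus_commute dot_square_norm)
  have vv: "v \<bullet> v = 1" using dist_ac by (simp add: v_def dist_norm norm_minus_commute dot_square_norm)
  have "(u - v) \<bullet> (u - v) = 1" using dist_bc by (simp add: u_def v_def dist_norm dot_square_norm)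
  then have uv: "u \<bullet> v = 1 / 2" using uu vv by (simp add: inner_diff inner_commute[of v u])
  have "vert n i j - vert n k l = (1/2) ^ n *\<^sub>R (x *\<^sub>R u + y *\<^sub>R v)"
    by (simp add: vert_def u_def[symmetric] v_def[symmetric] x_def y_def algebra_simps)
  then have "(dist (vert n i j) (vert n k l))\<^sup>2 = ((1/2) ^ n)\<^sup>2 * ((x *\<^sub>R u + y *\<^sub>R v) \<bullet> (x *\<^sub>R u + y *\<^sub>R v))"
    by (simp add: dist_norm power_mult_distrib dot_square_norm)
  also have "(x *\<^sub>R u + y *\<^sub>R v) \<bullet> (x *\<^sub>R u + y *\<^sub>R v) = x\<^sup>2 + x * y + y\<^sup>2"
    by (simp add: inner_add uu vv uv inner_commute[of v u] power2_eq_square algebra_simps)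
  finally show ?thesis by (simp add: x_def y_def)
qed

lemma dist_cell:
  assumes "cell n i j = (p, q, s)"
  shows "dist p q = (1/2) ^ n" "dist p s = (1/2) ^ n" "dist q s = (1/2) ^ n"
proof -
  have p: "p = vert n i j" "q = vert n (Suc i) j" "s = vert n i (Suc j)"
    using assms by (auto simp: cell_def)
  have "(dist p q)\<^sup>2 = ((1/2) ^ n)\<^sup>2" "(dist p s)\<^sup>2 = ((1/2) ^ n)\<^sup>2" "(dist q s)\<^sup>2 = ((1/2) ^ n)\<^sup>2"
    unfolding p dist_vert_sqr by (simp_all add: power2_eq_square)
  then show "dist p q = (1/2) ^ n" "dist p s = (1/2) ^ n" "dist q s = (1/2) ^ n"
    by (auto simp: power2_eq_iff_nonneg)
qed

lemma vert_index_close: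
  assumes "dist (vert n i j) (vert n k l) \<le> 3 * (1/2) ^ n"
  shows "\<bar>int i - int k\<bar> \<le> 3" "\<bar>int j - int l\<bar> \<le> 3"
proof -
  define x y where "x = real i - k" and "y = real j - l"
  have "(dist (vert n i j) (vert n k l))\<^sup>2 \<le> (3 * (1/2) ^ n)\<^sup>2"
    using assms by (intro power_mono) auto
  then have "((1/2) ^ n)\<^sup>2 * (x\<^sup>2 + x * y + y\<^sup>2) \<le> ((1/2) ^ n)\<^sup>2 * 9"
    unfolding dist_vert_sqr x_def y_def by (simp add: power_mult_distrib)
  then have s: "x\<^sup>2 + x * y + y\<^sup>2 \<le> 9"
    by (subst (asm) mult_le_cancel_left_pos) auto
  \<comment> \<open>\<open>4 * (x\<^sup>2 + x * y + y\<^sup>2) = 3 * x\<^sup>2 + (x + 2 *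
    y)\<^sup>2\<close>, so \<open>x\<^sup>2 \<le> 12 < 16\<close>, and likewise for
    \<open>y\<close>.\<close>
  have "(x + 2 * y)\<^sup>2 \<ge> 0" "(y + 2 * x)\<^sup>2 \<ge> 0" by auto
  then have "x\<^sup>2 < 4\<^sup>2" "y\<^sup>2 < 4\<^sup>2" using s by (auto simp: power2_eq_square algebra_simps)
  then have "\<bar>x\<bar> < 4" "\<bar>y\<bar> < 4" by (auto simp: abs_le_square_iff dest: power2_less_imp_less intro: power2_less_imp_less)
  then show "\<bar>int i - int k\<bar> \<le> 3" "\<bar>int j - int l\<bar> \<le> 3"
    unfolding x_def y_def by linarith+
qed

section \<open>Edges, vertices and compactness\<close>

fun edges :: "'a \<times> 'a \<times> 'a \<Rightarrow> 'a set" where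
  "edges (p, q, s) = closed_segment p q \<union> closed_segment p s \<union> closed_segment q s"

lemma edges_subset_hull: "edges (p, q, s) \<subseteq> convex hull {p, q, s}"
  unfolding edges.simps segment_convex_hull by (intro Un_least hull_mono) auto

text \<open>Each half of an edge is an edge of a child. Iterated, this makes edges survive all later
  steps and supplies connected paths inside \<open>\<Delta>\<close>.\<close>

lemma edges_child:
  assumes "x \<in> edges T"
  shows "\<exists>S\<in>subdivide T. x \<in> edges S"
proof -
  obtain p q s where T: "T = (p, q, s)" by (metis prod_cases3)
  have split: "closed_segment u v = closed_segment u (midpoint u v) \<union> closed_segment (midpoint u v) v" for u v :: 'a
    by (rule Un_closed_segment[symmetric]) simp
  show ?thesis
    using assms unfolding T edges.simps subdivide.simps split[of p q] split[of p s] split[of q s]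
    by auto
qed

lemma edges_in_level:
  assumes "T \<in> step_triangles a b c n" "x \<in> edges T"
  shows "x \<in> sierpinski_level a b c (n + k)"
proof -
  have "\<exists>S\<in>step_triangles a b c (n + k). x \<in> edges S"
  proof (induction k)
    case 0
    then show ?case using assms by auto
  next
    case (Suc k)
    then obtain S where "S \<in> step_triangles a b c (n + k)" "x \<in> edges S" by blast
    then show ?case using edges_child[of x S] step_triangles_child[of S "n + k"] by fastforce
  qed
  then obtain p q s where "(p, q, s) \<in> step_triangles a b c (n + k)" "x \<in> edges (p, q, s)" by auto
  then show ?thesis
    unfolding sierpinski_level_def using edges_subset_hull by blast
qed

lemma level_Suc_subset: "sierpinski_level a b c (Suc n) \<subseteq> sierpinski_level a b c n"
proof
  fix x assume "x \<in> sierpinski_level a b c (Suc n)"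
  then obtain T p q s where T: "T \<in> step_triangles a b c n" "(p, q, s) \<in> subdivide T"
    "x \<in> convex hull {p, q, s}"
    unfolding sierpinski_level_def by auto
  obtain p' q' s' where T': "T = (p', q', s')" by (metis prod_cases3)
  let ?H = "convex hull {p', q', s'}"
  have H: "p' \<in> ?H" "q' \<in> ?H" "s' \<in> ?H" by (auto intro: hull_inc)
  then have "midpoint p' q' \<in> ?H" "midpoint p' s' \<in> ?H" "midpoint q' s' \<in> ?H"
    by (auto intro!: convexD[OF convex_convex_hull] simp: midpoint_def scaleR_add_right)
  with H have "{p, q, s} \<subseteq> ?H" using T(2) unfolding T' by auto
  then have "convex hull {p, q, s} \<subseteq> ?H" by (rule hull_minimal) simp
  then show "x \<in> sierpinski_level a b c n"
    using T unfolding sierpinski_level_def T' by blast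
qed

lemma edges_subset_sierpinski:
  assumes "T \<in> step_triangles a b c n"
  shows "edges T \<subseteq> \<Delta>"
proof
  fix x assume x: "x \<in> edges T"
  have "x \<in> sierpinski_level a b c m" for m
  proof -
    have "x \<in> sierpinski_level a b c (n + m)" by (rule edges_in_level[OF assms x])
    moreover have "sierpinski_level a b c (n + m) \<subseteq> sierpinski_level a b c m"
      by (rule lift_Suc_antimono_le[of "sierpinski_level a b c"]) (use level_Suc_subset in auto)
    ultimately show ?thesis by auto
  qed
  then show "x \<in> \<Delta>" by (simp add: sierpinski_def)
qed

lemma step_vertices_in_sierpinski:
  assumes "(p, q, s) \<in> step_triangles a b c n"
  shows "p \<in> \<Delta>" "q \<in> \<Delta>" "s \<in> \<Delta>"
  using edges_subset_sierpinski[OF assms] by auto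

lemma finite_step_triangles: "finite (step_triangles a b c n)"
proof (induction n)
  case (Suc n)
  have "finite (subdivide T)" for T :: "'a \<times> 'a \<times> 'a" by (cases T) auto
  with Suc show ?case by auto
qed auto

lemma compact_sierpinski: "compact \<Delta>"
proof -
  have "compact (sierpinski_level a b c n)" for n
    unfolding sierpinski_level_def
    by (intro compact_UN finite_step_triangles) (auto intro!: finite_imp_compact_convex_hull)
  then show ?thesis
    unfolding sierpinski_def using compact_Inter[of "range (sierpinski_level a b c)"] by auto
qed

lemma sierpinski_near_vertex:
  assumes "x \<in> \<Delta>"
  obtains p q s where "(p, q, s) \<in> step_triangles a b c n" "dist x p \<le> (1/2) ^ n"
proof -
  obtain p q s where T: "(p, q, s) \<in> step_triangles a b c n" "x \<in> convex hull {p, q, s}"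
    using assms unfolding sierpinski_def sierpinski_level_def by blast
  obtain i j where "cell n i j = (p, q, s)" using step_triangles_cell[OF T(1)] by metis
  note d = dist_cell[OF this]
  have "convex hull {p, q, s} \<subseteq> cball p ((1/2) ^ n)"
    using d by (intro hull_minimal) auto
  then have "dist x p \<le> (1/2) ^ n" using T(2) by (auto simp: dist_commute)
  with T(1) that show ?thesis by blast
qed

lemma dist_sierpinski_le:
  assumes "x \<in> \<Delta>" "y \<in> \<Delta>"
  shows "dist x y \<le> 2"
proof -
  have "dist z a \<le> 1" if "z \<in> \<Delta>" for z
    using sierpinski_near_vertex[OF that, of 0] by auto
  then show ?thesis using assms dist_triangle2[of x y a] by (smt (verit))
qed

end

subsection \<open>Box dimension of level sets\<close>

text \<open>Total boundedness provides some finite cover, so the \<open>LEAST\<close> in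
  \<open>covering_number\<close> is attained by an actual cover.\<close>

lemma finite_small_cover:
  fixes F :: "'a::euclidean_space set"
  assumes "bounded F" "\<delta> > 0"
  obtains \<U> where "finite \<U>" "card \<U> = covering_number \<delta> F" "F \<subseteq> \<Union>\<U>"
    "\<And>U. U \<in> \<U> \<Longrightarrow> bounded U \<and> diameter U \<le> \<delta>"
proof -
  let ?P = "\<lambda>n. \<exists>\<U>. finite \<U> \<and> card \<U> = n \<and> F \<subseteq> \<Union>\<U> \<and> (\<forall>U\<in>\<U>. bounded U \<and> diameter U \<le> \<delta>)"
  have "compact (closure F)" using assms by (simp add: compact_closure)
  then obtain K where K: "finite K" "closure F \<subseteq> (\<Union>x\<in>K. ball x (\<delta> / 2))"
    using compact_imp_seq_compact seq_compact_imp_totally_bounded \<open>\<delta> > 0\<close> by (metis half_gt_zero)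
  have "\<forall>U\<in>(\<lambda>x. ball x (\<delta> / 2)) ` K. bounded U \<and> diameter U \<le> \<delta>"
    using \<open>\<delta> > 0\<close> by auto
  moreover have "F \<subseteq> \<Union>((\<lambda>x. ball x (\<delta> / 2)) ` K)"
    using K closure_subset by fastforce
  ultimately have "?P (card ((\<lambda>x. ball x (\<delta> / 2)) ` K))"
    using K(1) by blast
  then have "?P (covering_number \<delta> F)"
    unfolding covering_number_def by (rule LeastI)
  then show ?thesis using that by blast
qed

lemma covering_number_empty: "covering_number \<delta> {} = 0"
  unfolding covering_number_def by (rule Least_eq_0) (auto intro: exI[of _ "{}"])

lemma lower_box_dim_empty: "lower_box_dim {} = 0"
proof -
  have "at_right (0::real) \<noteq> bot" by simp
  then show ?thesis
    unfolding lower_box_dim_def covering_number_empty by (simp add: Liminf_const zero_ereal_def)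
qed

lemma holder1_on_dist:
  assumes "holder1_on \<alpha> F f" "u \<in> F" "v \<in> F"
  shows "\<bar>f u - f v\<bar> \<le> dist u v powr \<alpha>"
  using assms unfolding holder1_on_def by blast

lemma holder1_on_continuous:
  assumes "holder1_on \<alpha> F f" "\<alpha> > 0"
  shows "continuous_on F f"
  unfolding continuous_on_iff
proof (intro ballI allI impI)
  fix x and e :: real assume x: "x \<in> F" "e > 0"
  show "\<exists>d>0. \<forall>z\<in>F. dist z x < d \<longrightarrow> dist (f z) (f x) < e"
  proof (intro exI[of _ "e powr (1 / \<alpha>)"] conjI ballI impI)
    fix z assume z: "z \<in> F" "dist z x < e powr (1 / \<alpha>)"
    have "\<bar>f z - f x\<bar> \<le> dist z x powr \<alpha>" using holder1_on_dist[OF assms(1) z(1) x(1)] .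
    also have "\<dots> < (e powr (1 / \<alpha>)) powr \<alpha>"
      using z assms(2) by (intro powr_less_mono2) auto
    also have "\<dots> = e" using x assms(2) by (simp add: powr_powr)
    finally show "dist (f z) (f x) < e" by (simp add: dist_real_def)
  qed (use x in auto)
qed

section \<open>Crossed cells versus covers of a level set\<close>

context unit_triangle
begin

lemma half_power_powr: "((1/2) ^ n :: real) powr \<alpha> = 2 powr (- \<alpha> * n)"
proof -
  have "((1/2) ^ n :: real) = 2 powr (- real n)"
    by (simp add: powr_minus powr_realpow power_one_over inverse_eq_divide)
  then show ?thesis by (simp add: powr_powr mult.commute)
qed

lemma increments_le_cell:
  assumes "holder1_on \<alpha> \<Delta> f" "cell m i j \<in> step_triangles a b c m"
  shows "increments_le f (2 powr (- \<alpha> * (m + n))) n (cell m i j)"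
  using assms(2)
proof (induction n arbitrary: m i j)
  case 0
  obtain p q s where e: "cell m i j = (p, q, s)" by (metis prod_cases3)
  note v = step_vertices_in_sierpinski[OF 0[unfolded e]]
  show ?case
    using holder1_on_dist[OF assms(1) v(1,2)] holder1_on_dist[OF assms(1) v(1,3)]
      holder1_on_dist[OF assms(1) v(2,3)]
    unfolding e dist_cell[OF e] half_power_powr by simp
next
  case (Suc n)
  obtain p q s where e: "cell m i j = (p, q, s)" by (metis prod_cases3)
  show ?case
    using Suc.IH[OF cell_children_step(1)[OF Suc.prems]] Suc.IH[OF cell_children_step(2)[OF Suc.prems]]
      Suc.IH[OF cell_children_step(3)[OF Suc.prems]]
    by (simp add: e cell_children[OF e] add_ac)
qed

text \<open>The count is realised by distinct cells. The conditions on \<open>div\<close> strengthen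
  the induction: they show that families coming from different children are disjoint.\<close>

lemma crossings_index_set:
  assumes "cell m i j \<in> step_triangles a b c m"
  shows "\<exists>X. finite X \<and> card X = crossings f r k (cell m i j) \<and>
    (\<forall>(i', j')\<in>X. cell (m + k) i' j' \<in> step_triangles a b c (m + k) \<and>
       crossings f r 0 (cell (m + k) i' j') > 0 \<and> i' div 2 ^ k = i \<and> j' div 2 ^ k = j)"
  using assms
proof (induction k arbitrary: m i j)
  case 0
  show ?case
  proof (cases "crossings f r 0 (cell m i j) > 0")
    case True
    moreover have "crossings f r 0 (cell m i j) \<le> 1"
      by (cases "cell m i j") (simp only: crossings.simps of_bool_def, simp)
    ultimately have "crossings f r 0 (cell m i j) = 1" by linarith
    with True 0 show ?thesis by (intro exI[of _ "{(i, j)}"]) auto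
  qed (intro exI[of _ "{}"], auto)
next
  case (Suc k)
  obtain p q s where e: "cell m i j = (p, q, s)" by (metis prod_cases3)
  show ?case
  proof (cases "crossings f r (Suc k) (cell m i j) > 0")
    case False
    then show ?thesis by (intro exI[of _ "{}"]) auto
  next
    case True
    note ch = cell_children_step[OF Suc.prems]
    obtain X where X: "finite X" "card X = crossings f r k (cell (Suc m) (2 * i) (2 * j))"
      "\<forall>(i', j')\<in>X. cell (Suc m + k) i' j' \<in> step_triangles a b c (Suc m + k) \<and>
       crossings f r 0 (cell (Suc m + k) i' j') > 0 \<and> i' div 2 ^ k = 2 * i \<and> j' div 2 ^ k = 2 * j"
      using Suc.IH[OF ch(1)] by blast
    obtain Y where Y: "finite Y" "card Y = crossings f r k (cell (Suc m) (Suc (2 * i)) (2 * j))"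
      "\<forall>(i', j')\<in>Y. cell (Suc m + k) i' j' \<in> step_triangles a b c (Suc m + k) \<and>
       crossings f r 0 (cell (Suc m + k) i' j') > 0 \<and> i' div 2 ^ k = Suc (2 * i) \<and> j' div 2 ^ k = 2 * j"
      using Suc.IH[OF ch(2)] by blast
    obtain Z where Z: "finite Z" "card Z = crossings f r k (cell (Suc m) (2 * i) (Suc (2 * j)))"
      "\<forall>(i', j')\<in>Z. cell (Suc m + k) i' j' \<in> step_triangles a b c (Suc m + k) \<and>
       crossings f r 0 (cell (Suc m + k) i' j') > 0 \<and> i' div 2 ^ k = 2 * i \<and> j' div 2 ^ k = Suc (2 * j)"
      using Suc.IH[OF ch(3)] by blast
    have disj: "X \<inter> Y = {}" "(X \<union> Y) \<inter> Z = {}"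
      using X(3) Y(3) Z(3) by fastforce+
    have div: "u div (2 * 2 ^ k) = u div 2 ^ k div 2" for u :: nat
      by (simp add: div_mult2_eq[symmetric] mult.commute)
    have "card (X \<union> Y \<union> Z) = card X + card Y + card Z"
      using X(1) Y(1) Z(1) disj by (simp add: card_Un_disjoint)
    also have "\<dots> = crossings f r (Suc k) (cell m i j)"
      using crossings_Suc_ge[OF True[unfolded e]] X(2) Y(2) Z(2) by (simp add: e cell_children[OF e])
    finally have card: "card (X \<union> Y \<union> Z) = crossings f r (Suc k) (cell m i j)" .
    show ?thesis
      by (intro exI[of _ "X \<union> Y \<union> Z"] conjI card)
         (use X(1,3) Y(1,3) Z(1,3) in \<open>fastforce simp: div\<close>)+
  qed
qed

text \<open>Some edge has its endpoints on different sides of \<open>r\<close>; it is connected and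
  lies in \<open>\<Delta>\<close>, so the intermediate value theorem applies on it.\<close>

lemma crossed_cell_meets_level_set:
  assumes "continuous_on \<Delta> f" "cell n i j \<in> step_triangles a b c n"
    and "crossings f r 0 (cell n i j) > 0"
  obtains z where "z \<in> level_set \<Delta> f r" "dist z (vert n i j) \<le> (1/2) ^ n"
proof -
  obtain p q s where e: "cell n i j = (p, q, s)" by (metis prod_cases3)
  then have p: "p = vert n i j" by (simp add: cell_def)
  have cross: "\<exists>z\<in>closed_segment u v. f z = r"
    if "(f u < r) \<noteq> (f v < r)" "closed_segment u v \<subseteq> \<Delta>" for u v
  proof -
    have "connected (f ` closed_segment u v)"
      by (intro connected_continuous_image continuous_on_subset[OF assms(1)] that connected_segment)
    moreover have "f u \<in> f ` closed_segment u v" "f v \<in> f ` closed_segment u v" by auto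
    ultimately have "{f u..f v} \<subseteq> f ` closed_segment u v" "{f v..f u} \<subseteq> f ` closed_segment u v"
      by (auto intro: connected_contains_Icc[THEN subsetD])
    moreover have "r \<in> {f u..f v} \<or> r \<in> {f v..f u}" using that(1) by auto
    ultimately show ?thesis by blast
  qed
  have sub: "edges (p, q, s) \<subseteq> \<Delta>" using edges_subset_sierpinski[OF assms(2)] by (simp add: e)
  have "(f p < r) \<noteq> (f q < r) \<or> (f q < r) \<noteq> (f s < r)"
    using assms(3) by (auto simp: e)
  then obtain z where z: "z \<in> edges (p, q, s)" "f z = r"
    using cross[of p q] cross[of q s] sub by auto
  have "convex hull {p, q, s} \<subseteq> cball p ((1/2) ^ n)"
    using dist_cell[OF e] by (intro hull_minimal) auto
  then have "z \<in> cball p ((1/2) ^ n)" using edges_subset_hull[of p q s] z(1) by auto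
  then have "dist z p \<le> (1/2) ^ n" by (simp add: dist_commute)
  moreover have "z \<in> level_set \<Delta> f r" using z sub by (auto simp: level_set_def)
  ultimately show ?thesis using that p by blast
qed

lemma card_close_indices:
  assumes "\<And>x y. x \<in> X \<Longrightarrow> y \<in> X \<Longrightarrow>
    dist (vert n (fst x) (snd x)) (vert n (fst y) (snd y)) \<le> 3 * (1/2) ^ n"
  shows "card X \<le> 49"
proof (cases "X = {}")
  case False
  then obtain x where x: "x \<in> X" by blast
  define h where "h z = (int (fst z), int (snd z))" for z :: "nat \<times> nat"
  have "h ` X \<subseteq> {int (fst x) - 3..int (fst x) + 3} \<times> {int (snd x) - 3..int (snd x) + 3}"
  proof
    fix w assume "w \<in> h ` X"
    then obtain z where z: "z \<in> X" "w = h z" by blast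
    show "w \<in> {int (fst x) - 3..int (fst x) + 3} \<times> {int (snd x) - 3..int (snd x) + 3}"
      using vert_index_close[OF assms[OF z(1) x]] by (auto simp: z(2) h_def)
  qed
  then have "card (h ` X) \<le> card ({int (fst x) - 3..int (fst x) + 3} \<times> {int (snd x) - 3..int (snd x) + 3})"
    by (intro card_mono) auto
  also have "\<dots> = 49" by (simp add: card_cartesian_product)
  also have "card (h ` X) = card X"
    by (intro card_image inj_onI) (auto simp: h_def prod_eq_iff)
  finally show ?thesis .
qed simp

text \<open>One point of the level set is chosen for each crossed cell; a single set of the cover
  can serve at most 49 cells.\<close>

lemma crossings_le_covering_number:
  assumes "continuous_on \<Delta> f" "cell m i j \<in> step_triangles a b c m"
    and "\<delta> > 0" "\<delta> \<le> (1/2) ^ (m + k)"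
  shows "crossings f r k (cell m i j) \<le> 49 * covering_number \<delta> (level_set \<Delta> f r)"
proof -
  let ?F = "level_set \<Delta> f r" and ?n = "m + k"
  have "bounded ?F"
    by (rule bounded_subset[OF compact_imp_bounded[OF compact_sierpinski]]) (auto simp: level_set_def)
  then obtain \<U> where U: "finite \<U>" "card \<U> = covering_number \<delta> ?F" "?F \<subseteq> \<Union>\<U>"
    "\<And>U. U \<in> \<U> \<Longrightarrow> bounded U \<and> diameter U \<le> \<delta>"
    by (rule finite_small_cover[OF _ \<open>\<delta> > 0\<close>]) blast
  obtain X where X: "finite X" "card X = crossings f r k (cell m i j)"
    "\<And>x. x \<in> X \<Longrightarrow> cell ?n (fst x) (snd x) \<in> step_triangles a b c ?n
       \<and> crossings f r 0 (cell ?n (fst x) (snd x)) > 0"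
    using crossings_index_set[OF assms(2), of f r k] by fastforce
  have "\<forall>x\<in>X. \<exists>z. z \<in> ?F \<and> dist z (vert ?n (fst x) (snd x)) \<le> (1/2) ^ ?n"
  proof
    fix x assume "x \<in> X"
    note X(3)[OF this]
    then show "\<exists>z. z \<in> ?F \<and> dist z (vert ?n (fst x) (snd x)) \<le> (1/2) ^ ?n"
      using crossed_cell_meets_level_set[OF assms(1)] by metis
  qed
  then obtain z where z: "\<And>x. x \<in> X \<Longrightarrow> z x \<in> ?F"
    "\<And>x. x \<in> X \<Longrightarrow> dist (z x) (vert ?n (fst x) (snd x)) \<le> (1/2) ^ ?n"
    by metis
  have "X = (\<Union>U\<in>\<U>. {x\<in>X. z x \<in> U})" using z(1) U(3) by blast
  then have "card X \<le> (\<Sum>U\<in>\<U>. card {x\<in>X. z x \<in> U})"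
    using card_UN_le[OF U(1), of "\<lambda>U. {x\<in>X. z x \<in> U}"] by simp
  also have "\<dots> \<le> (\<Sum>U\<in>\<U>. 49)"
  proof (intro sum_mono card_close_indices[where n = ?n])
    fix U x y assume U': "U \<in> \<U>" and xy: "x \<in> {x\<in>X. z x \<in> U}" "y \<in> {x\<in>X. z x \<in> U}"
    have "dist (z x) (z y) \<le> \<delta>"
      using diameter_bounded_bound[of U "z x" "z y"] U(4)[OF U'] xy by auto
    then have "dist (z x) (z y) \<le> (1/2) ^ ?n" using assms(4) by simp
    \<comment> \<open>Two distances from a chosen point to its corner and one diameter, each at most
      \<open>(1/2) ^ ?n\<close>, give the factor 3.\<close>
    then show "dist (vert ?n (fst x) (snd x)) (vert ?n (fst y) (snd y)) \<le> 3 * (1/2) ^ ?n"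
      using z(2)[of x] z(2)[of y] xy
        dist_triangle[of "vert ?n (fst x) (snd x)" "vert ?n (fst y) (snd y)" "z x"]
        dist_triangle[of "z x" "vert ?n (fst y) (snd y)" "z y"]
      by (simp add: dist_commute)
  qed
  also have "\<dots> = 49 * covering_number \<delta> ?F" using U(2) by simp
  finally show ?thesis using X(2) by simp
qed

lemma lower_box_dim_ge:
  fixes d :: real
  assumes "continuous_on \<Delta> f" "cell m i j \<in> step_triangles a b c m" and "d > 0"
    and ev: "\<forall>\<^sub>F n in sequentially. 2 powr (d * n) \<le> real (crossings f r n (cell m i j))"
  shows "lower_box_dim (level_set \<Delta> f r) \<ge> ereal d"
proof -
  let ?cov = "\<lambda>\<delta>. real (covering_number \<delta> (level_set \<Delta> f r))"
  \<comment> \<open>The 49 comes from comparing cells with covers; the exponent \<open>1 + m\<close>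
    pays for rounding the scale and for starting at level \<open>m\<close>.\<close>
  define K where "K = 2 powr (- d * (1 + m)) / 49"
  have K: "K > 0" by (simp add: K_def)
  obtain N where N: "\<And>n. n \<ge> N \<Longrightarrow> 2 powr (d * n) \<le> real (crossings f r n (cell m i j))"
    using ev by (auto simp: eventually_sequentially)
  define g where "g \<delta> = d + ln K / (- ln \<delta>)" for \<delta> :: real
  have "(\<forall>\<^sub>F \<delta> in at_right 0. \<delta> \<in> {0<..<(1/2 :: real) ^ (m + N + 1)})"
    by (rule eventually_at_right_real) simp
  then have "\<forall>\<^sub>F \<delta> in at_right 0. ereal (g \<delta>) \<le> ereal (ln (?cov \<delta>) / - ln \<delta>)"
  proof eventually_elim
    case (elim \<delta>)
    then have \<delta>: "\<delta> > 0" "\<delta> < (1/2) ^ (m + N + 1)" by auto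
    define L where "L = - log 2 \<delta>"
    have \<delta>L: "\<delta> = 2 powr (- L)" using \<delta>(1) by (simp add: L_def)
    have hp: "((1/2) ^ n :: real) = 2 powr (- real n)" for n
      by (simp add: powr_minus powr_realpow power_one_over inverse_eq_divide)
    have "2 powr (- L) < 2 powr (- real (m + N + 1))" using \<delta>(2) unfolding \<delta>L hp .
    then have L: "L > real (m + N + 1)" by simp
    \<comment> \<open>\<open>m + k\<close> is the integer part of \<open>L\<close>, so
      \<open>\<delta>\<close> lies between consecutive dyadic scales. The bound on \<open>L\<close>
      rules out truncation in the subtraction and ensures \<open>k \<ge> N\<close>.\<close>
    define k where "k = nat \<lfloor>L\<rfloor> - m"
    have k: "k \<ge> N" "real (m + k) \<le> L" "L - 1 \<le> real (m + k)"
      using L unfolding k_def by linarith+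
    have "2 powr (d * (L - 1 - m)) \<le> 2 powr (d * k)"
      using k \<open>d > 0\<close> by (intro powr_mono mult_left_mono) auto
    also have "\<dots> \<le> real (crossings f r k (cell m i j))" by (rule N[OF k(1)])
    also have "\<dots> \<le> 49 * ?cov \<delta>"
    proof -
      have "\<delta> \<le> (1/2) ^ (m + k)" unfolding \<delta>L hp using k(2) by simp
      from crossings_le_covering_number[OF assms(1,2) \<delta>(1) this, of r] show ?thesis by linarith
    qed
    also have "2 powr (d * (L - 1 - m)) = 49 * (K * \<delta> powr (- d))"
      unfolding K_def \<delta>L by (simp add: powr_powr powr_add[symmetric] algebra_simps)
    finally have cov: "K * \<delta> powr (- d) \<le> ?cov \<delta>" by simp
    have "\<delta> < 1" using \<delta>(2) power_le_one[of "1/2::real" "m + N + 1"] by simp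
    then have ln: "- ln \<delta> > 0" using \<delta>(1) by simp
    have "ln (K * \<delta> powr (- d)) \<le> ln (?cov \<delta>)"
      using cov K \<delta>(1) by (intro ln_mono) auto
    then have "(ln K - d * ln \<delta>) / (- ln \<delta>) \<le> ln (?cov \<delta>) / (- ln \<delta>)"
      using K \<delta>(1) ln by (intro divide_right_mono) (auto simp: ln_mult ln_powr)
    moreover have "(ln K - d * ln \<delta>) / (- ln \<delta>) = g \<delta>"
      using ln by (simp add: g_def field_simps)
    ultimately show ?case by simp
  qed
  then have "Liminf (at_right 0) (\<lambda>\<delta>. ereal (g \<delta>)) \<le> lower_box_dim (level_set \<Delta> f r)"
    unfolding lower_box_dim_def by (rule Liminf_mono)
  moreover have "Liminf (at_right 0) (\<lambda>\<delta>. ereal (g \<delta>)) = ereal d"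
  proof (rule lim_imp_Liminf)
    have "(g \<longlongrightarrow> d) (at_right 0)" unfolding g_def[abs_def] by real_asymp
    then show "((\<lambda>\<delta>. ereal (g \<delta>)) \<longlongrightarrow> ereal d) (at_right 0)" by simp
  qed simp
  ultimately show ?thesis by simp
qed

section \<open>Almost every value of a Hoelder function\<close>

lemma uncrossed_level_extremal:
  assumes f: "holder1_on \<alpha> \<Delta> f" and "\<alpha> > 0"
    and un: "\<And>n i j. cell n i j \<in> step_triangles a b c n \<Longrightarrow> crossings f r 0 (cell n i j) = 0"
  shows "(\<forall>x\<in>\<Delta>. f x \<le> r) \<or> (\<forall>x\<in>\<Delta>. r \<le> f x)"
proof -
  have un': "(f p < r) = (f q < r) \<and> (f q < r) = (f s < r)"
    if T: "(p, q, s) \<in> step_triangles a b c n" for p q s n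
  proof -
    obtain i j where e: "(p, q, s) = cell n i j" by (rule step_triangles_cell[OF T])
    show ?thesis using un[OF T[unfolded e]] unfolding e[symmetric] by auto
  qed
  \<comment> \<open>Every child keeps a corner of its parent, so with all triangles uncrossed the
    side of \<open>a\<close> propagates to every vertex; density of the vertices does the
    rest.\<close>
  have side: "(f p < r) = (f a < r)" if "(p, q, s) \<in> step_triangles a b c n" for p q s n
    using that
  proof (induction n arbitrary: p q s)
    case 0
    then show ?case by simp
  next
    case (Suc n)
    then obtain p' q' s' where T: "(p', q', s') \<in> step_triangles a b c n" "(p, q, s) \<in> subdivide (p', q', s')"
      by auto
    have "p' \<in> {p, q, s} \<or> q' \<in> {p, q, s} \<or> s' \<in> {p, q, s}" using T(2) by auto
    with un'[OF Suc.prems] un'[OF T(1)] Suc.IH[OF T(1)] show ?case by auto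
  qed
  have lim: "(\<lambda>n. 2 powr (- \<alpha> * real n)) \<longlonglongrightarrow> 0"
    using \<open>\<alpha> > 0\<close> by real_asymp
  have near: "\<exists>p. (f p < r) = (f a < r) \<and> \<bar>f x - f p\<bar> \<le> 2 powr (- \<alpha> * real n)" if x: "x \<in> \<Delta>" for x n
  proof -
    obtain p q s where p: "(p, q, s) \<in> step_triangles a b c n" "dist x p \<le> (1/2) ^ n"
      by (rule sierpinski_near_vertex[OF x])
    have "\<bar>f x - f p\<bar> \<le> dist x p powr \<alpha>"
      by (rule holder1_on_dist[OF f x step_vertices_in_sierpinski(1)[OF p(1)]])
    also have "\<dots> \<le> ((1/2) ^ n) powr \<alpha>"
      using p(2) \<open>\<alpha> > 0\<close> by (intro powr_mono2) auto
    finally show ?thesis using side[OF p(1)] unfolding half_power_powr by blast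
  qed
  show ?thesis
  proof (cases "f a < r")
    case True
    have "f x \<le> r" if "x \<in> \<Delta>" for x
    proof -
      have "f x - r \<le> 2 powr (- \<alpha> * real n)" for n using near[OF that, of n] True by auto
      then have "f x - r \<le> 0" by (intro LIMSEQ_le_const[OF lim]) auto
      then show ?thesis by simp
    qed
    then show ?thesis by blast
  next
    case False
    have "r \<le> f x" if "x \<in> \<Delta>" for x
    proof -
      have "r - f x \<le> 2 powr (- \<alpha> * real n)" for n using near[OF that, of n] False by auto
      then have "r - f x \<le> 0" by (intro LIMSEQ_le_const[OF lim]) auto
      then show ?thesis by simp
    qed
    then show ?thesis by blast
  qed
qed

lemma AE_lower_box_dim_level_set:
  assumes \<alpha>: "0 < \<alpha>" "\<alpha> \<le> 1" and f: "holder1_on \<alpha> \<Delta> f"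
  shows "AE r in lebesgue. r \<in> f ` \<Delta> \<longrightarrow> lower_box_dim (level_set \<Delta> f r) \<ge> ereal (h_B_inv \<alpha>)"
proof -
  define D where "D = h_B_inv \<alpha>"
  have D: "0 < D" "D \<le> 1/3" "h_B D = \<alpha>" using h_B_inv[OF \<alpha>] by (auto simp: D_def)
  \<comment> \<open>The estimate needs \<open>h_B d < \<alpha>\<close> strictly, so \<open>D\<close>
    is approached from below along a sequence and countably many null sets are discarded.\<close>
  define d where "d n = D * (1 - 1 / (real n + 2))" for n :: nat
  have "0 < 1 - 1 / (real n + 2)" "1 - 1 / (real n + 2) < 1" for n :: nat
    by (auto simp: field_simps)
  then have d: "0 < d n" "d n < D" for n
    using D(1) mult_strict_left_mono[of "1 - 1 / (real n + 2)" 1 D] by (auto simp: d_def)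
  have hd: "h_B (d n) < \<alpha>" for n
    using strict_mono_onD[OF strict_mono_on_h_B, of "d n" D] d[of n] D by auto
  have d_lim: "d \<longlonglongrightarrow> D" unfolding d_def[abs_def] by real_asymp
  have cont: "continuous_on \<Delta> f" by (rule holder1_on_continuous[OF f \<alpha>(1)])
  let ?large = "\<lambda>n m i j r. \<forall>\<^sub>F k in sequentially. 2 powr (d n * k) \<le> real (crossings f r k (cell m i j))"
  have "AE r in lborel. cell m i j \<in> step_triangles a b c m \<longrightarrow>
      crossings f r 0 (cell m i j) > 0 \<longrightarrow> ?large n m i j r" for n m i j
  proof (cases "cell m i j \<in> step_triangles a b c m")
    case True
    obtain p q s where e: "cell m i j = (p, q, s)" by (metis prod_cases3)
    have "increments_le f (2 powr (- \<alpha> * m) * 2 powr (- \<alpha> * k)) k (p, q, s)" for k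
      using increments_le_cell[OF f True, of k] by (simp add: e powr_add[symmetric] algebra_simps)
    then have "AE r in lborel. crossings f r 0 (p, q, s) > 0 \<longrightarrow>
        (\<forall>\<^sub>F k in sequentially. 2 powr (d n * k) \<le> real (crossings f r k (p, q, s)))"
      using d(2)[of n] D(2) by (intro AE_crossings_ge[OF d(1) _ hd, of _ "2 powr (- \<alpha> * m)"]) (auto intro: less_imp_le order_trans)
    then show ?thesis by (simp add: e)
  qed simp
  then have large: "AE r in lborel. \<forall>n m i j. cell m i j \<in> step_triangles a b c m \<longrightarrow>
      crossings f r 0 (cell m i j) > 0 \<longrightarrow> ?large n m i j r"
    by (simp add: AE_all_countable)
  have "AE r in lborel. r \<noteq> Sup (f ` \<Delta>)" "AE r in lborel. r \<noteq> Inf (f ` \<Delta>)"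
    by (rule AE_lborel_singleton)+
  with large have "AE r in lborel. r \<in> f ` \<Delta> \<longrightarrow> lower_box_dim (level_set \<Delta> f r) \<ge> ereal D"
  proof eventually_elim
    case (elim r)
    show ?case
    proof
      assume r: "r \<in> f ` \<Delta>"
      \<comment> \<open>\<open>r\<close> may lie outside the range of the values at
        \<open>a\<close>, \<open>b\<close>, \<open>c\<close>, so the crossed triangle may have to be
        taken at a deeper level.\<close>
      obtain m i j where T: "cell m i j \<in> step_triangles a b c m" "crossings f r 0 (cell m i j) > 0"
      proof (rule ccontr)
        assume "\<not> thesis"
        then have "\<And>m i j. cell m i j \<in> step_triangles a b c m \<Longrightarrow> crossings f r 0 (cell m i j) = 0"
          using that by blast
        then consider "\<forall>x\<in>\<Delta>. f x \<le> r" | "\<forall>x\<in>\<Delta>. r \<le> f x"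
          using uncrossed_level_extremal[OF f \<alpha>(1)] by blast
        then show False
        proof cases
          case 1
          then have "Sup (f ` \<Delta>) = r" using r by (intro cSup_eq_maximum) auto
          with elim show False by simp
        next
          case 2
          then have "Inf (f ` \<Delta>) = r" using r by (intro cInf_eq_minimum) auto
          with elim show False by simp
        qed
      qed
      have "ereal (d n) \<le> lower_box_dim (level_set \<Delta> f r)" for n
        using elim(1) T by (intro lower_box_dim_ge[OF cont T(1) d(1)]) blast
      then have "\<exists>N. \<forall>n\<ge>N. ereal (d n) \<le> lower_box_dim (level_set \<Delta> f r)" by blast
      moreover have "(\<lambda>n. ereal (d n)) \<longlonglongrightarrow> ereal D" using d_lim by simp
      ultimately show "ereal D \<le> lower_box_dim (level_set \<Delta> f r)"
        by (rule LIMSEQ_le_const2[rotated])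
    qed
  qed
  then show ?thesis unfolding D_def by (rule AE_completion)
qed

text \<open>A value strictly between two attained ones is not extremal, hence crosses some triangle,
  which meets its level set.\<close>

lemma Ioo_subset_image:
  assumes \<alpha>: "0 < \<alpha>" and f: "holder1_on \<alpha> \<Delta> f" and xy: "x \<in> \<Delta>" "y \<in> \<Delta>"
  shows "{f x<..<f y} \<subseteq> f ` \<Delta>"
proof
  fix r assume r: "r \<in> {f x<..<f y}"
  obtain m i j where T: "cell m i j \<in> step_triangles a b c m" "crossings f r 0 (cell m i j) > 0"
  proof (rule ccontr)
    assume "\<not> thesis"
    then have "\<And>m i j. cell m i j \<in> step_triangles a b c m \<Longrightarrow> crossings f r 0 (cell m i j) = 0"
      using that by blast
    then show False using uncrossed_level_extremal[OF f \<alpha>, of r] xy r by fastforce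
  qed
  then obtain z where "z \<in> level_set \<Delta> f r"
    using crossed_cell_meets_level_set[OF holder1_on_continuous[OF f \<alpha>]] by metis
  then show "r \<in> f ` \<Delta>" by (auto simp: level_set_def)
qed

lemma D_lower_box_fun_ge:
  assumes \<alpha>: "0 < \<alpha>" "\<alpha> \<le> 1" and f: "holder1_on \<alpha> \<Delta> f"
    and xy: "x \<in> \<Delta>" "y \<in> \<Delta>" "f x < f y"
  shows "D_lower_box_fun f \<Delta> \<ge> ereal (h_B_inv \<alpha>)"
proof -
  let ?D = "h_B_inv \<alpha>"
  define S where "S = {r. lower_box_dim (level_set \<Delta> f r) \<ge> ereal ?D}"
  have "compact (f ` \<Delta>)"
    by (rule compact_continuous_image[OF holder1_on_continuous[OF f \<alpha>(1)] compact_sierpinski])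
  then have I: "f ` \<Delta> \<in> sets lebesgue" by (simp add: compact_imp_closed borel_closed)
  have SI: "S \<subseteq> f ` \<Delta>"
  proof
    fix r assume "r \<in> S"
    then have "level_set \<Delta> f r \<noteq> {}"
      using h_B_inv(1)[OF \<alpha>] by (auto simp: S_def lower_box_dim_empty zero_ereal_def)
    then show "r \<in> f ` \<Delta>" by (auto simp: level_set_def)
  qed
  have "AE r in lebesgue. r \<in> f ` \<Delta> \<longrightarrow> r \<in> S"
    using AE_lower_box_dim_level_set[OF \<alpha> f] by (simp add: S_def)
  then obtain N where N: "N \<in> null_sets lebesgue" "{r. \<not> (r \<in> f ` \<Delta> \<longrightarrow> r \<in> S)} \<subseteq> N"
    by (auto simp: eventually_ae_filter)
  \<comment> \<open>Completeness of Lebesgue measure makes the exceptional set measurable and null,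
    so \<open>S\<close> differs from the range by a null set.\<close>
  have null: "f ` \<Delta> - S \<in> null_sets lebesgue"
    by (rule null_sets_completion_subset[OF _ N(1)]) (use N(2) in auto)
  then have "f ` \<Delta> - (f ` \<Delta> - S) \<in> sets lebesgue" using I by (auto intro: sets.Diff)
  moreover have "f ` \<Delta> - (f ` \<Delta> - S) = S" using SI by auto
  ultimately have S: "S \<in> sets lebesgue" by simp
  have "0 < emeasure lebesgue {f x<..<f y}" using xy(3) by simp
  also have "\<dots> \<le> emeasure lebesgue (f ` \<Delta>)"
    by (rule emeasure_mono[OF Ioo_subset_image[OF \<alpha>(1) f xy(1,2)] I])
  also have "\<dots> = emeasure lebesgue (f ` \<Delta> - (f ` \<Delta> - S))"
    by (rule emeasure_Diff_null_set[OF null I, symmetric])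
  also have "f ` \<Delta> - (f ` \<Delta> - S) = S" using SI by auto
  finally show ?thesis
    unfolding D_lower_box_fun_def S_def by (intro Sup_upper) blast
qed

section \<open>Generic functions are nonconstant\<close>

definition nonconstant :: "real \<Rightarrow> ('a \<Rightarrow> real) set" where
  "nonconstant \<alpha> = {f \<in> topspace (holder1_space \<alpha> \<Delta>). \<exists>x\<in>\<Delta>. \<exists>y\<in>\<Delta>. f x \<noteq> f y}"

abbreviation "cfun \<equiv> cfunspace (top_of_set \<Delta>) (euclidean_metric :: real metric)"

lemma topspace_holder1_space:
  "topspace (holder1_space \<alpha> \<Delta>) = mspace cfun \<inter> {f. holder1_on \<alpha> \<Delta> f}"
  by (simp add: holder1_space_def del: mspace_cfunspace)

lemma openin_nonconstant: "openin (holder1_space \<alpha> \<Delta>) (nonconstant \<alpha>)"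
proof -
  interpret M: Metric_space "mspace cfun" "mdist cfun" by (rule Metric_space_mspace_mdist)
  let ?U = "{f \<in> mspace cfun. \<exists>x\<in>\<Delta>. \<exists>y\<in>\<Delta>. f x \<noteq> f y}"
  have "openin (mtopology_of cfun) ?U"
    unfolding mtopology_of_def M.openin_mtopology
  proof (intro conjI allI impI)
    fix f assume "f \<in> ?U"
    then obtain x y where f: "f \<in> mspace cfun" "x \<in> \<Delta>" "y \<in> \<Delta>" "f x \<noteq> f y" by blast
    \<comment> \<open>Changing both values by at most a third of their difference cannot make them
      equal.\<close>
    define e where "e = \<bar>f x - f y\<bar> / 3"
    have "M.mball f e \<subseteq> ?U"
    proof
      fix g assume g: "g \<in> M.mball f e"
      then have g': "g \<in> mspace cfun" "mdist cfun f g \<le> e" by (auto simp del: mspace_cfunspace)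
      have "dist (f z) (g z) \<le> e" if "z \<in> \<Delta>" for z
        using mdist_cfunspace_imp_mdist_le[OF f(1) g', of z] that by simp
      from this[OF f(2)] this[OF f(3)] have "\<bar>f x - f y\<bar> \<le> 2 * e" if "g x = g y"
        using that abs_triangle_ineq4[of "f x - g x" "f y - g y"] by (simp add: dist_real_def)
      then have "g x \<noteq> g y" using f(4) by (auto simp: e_def)
      with g'(1) f(2,3) show "g \<in> ?U" by blast
    qed
    moreover have "e > 0" using f(4) by (simp add: e_def)
    ultimately show "\<exists>e>0. M.mball f e \<subseteq> ?U" by blast
  qed blast
  then have "openin (holder1_space \<alpha> \<Delta>) (?U \<inter> {f. holder1_on \<alpha> \<Delta> f})"
    unfolding holder1_space_def by (rule openin_subtopology_Int)
  also have "?U \<inter> {f. holder1_on \<alpha> \<Delta> f} = nonconstant \<alpha>"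
    unfolding nonconstant_def topspace_holder1_space by blast
  finally show ?thesis .
qed

lemma ab_in_sierpinski: "a \<in> \<Delta>" "b \<in> \<Delta>"
  using step_vertices_in_sierpinski[of a b c 0] by auto

text \<open>A constant function becomes nonconstant after adding a small multiple of the distance to \<open>a\<close>.\<close>

lemma nonconstant_dense:
  assumes \<alpha>: "0 < \<alpha>" "\<alpha> \<le> 1"
  shows "holder1_space \<alpha> \<Delta> closure_of nonconstant \<alpha> = topspace (holder1_space \<alpha> \<Delta>)"
proof (intro antisym closure_of_subset_topspace subsetI)
  interpret M: Metric_space "mspace cfun" "mdist cfun" by (rule Metric_space_mspace_mdist)
  fix f assume f: "f \<in> topspace (holder1_space \<alpha> \<Delta>)"
  have "\<exists>g. g \<in> nonconstant \<alpha> \<and> g \<in> T" if T: "f \<in> T" "openin (holder1_space \<alpha> \<Delta>) T" for T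
  proof (cases "f \<in> nonconstant \<alpha>")
    case True
    with T show ?thesis by blast
  next
    case False
    obtain T' where T': "openin (mtopology_of cfun) T'" "T = T' \<inter> {f. holder1_on \<alpha> \<Delta> f}"
      using T(2) unfolding holder1_space_def openin_subtopology by blast
    then obtain e where e: "e > 0" "M.mball f e \<subseteq> T'"
      using T(1) unfolding mtopology_of_def M.openin_mtopology by blast
    have fM: "f \<in> mspace cfun" using f by (simp add: topspace_holder1_space del: mspace_cfunspace)
    have const: "f x = f a" if "x \<in> \<Delta>" for x
      using False f that ab_in_sierpinski unfolding nonconstant_def by blast
    \<comment> \<open>\<open>\<Delta>\<close> has diameter at most \<open>2\<close>. Hence
      \<open>dist x y \<le> 2 * dist x y powr \<alpha>\<close>, so the factor \<open>1/2\<close>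
      yields Hoelder constant \<open>1\<close>, and \<open>e / 4\<close> keeps the supremum distance
      below \<open>e\<close>.\<close>
    define \<epsilon> where "\<epsilon> = min (1/2) (e / 4)"
    have \<epsilon>: "0 < \<epsilon>" "\<epsilon> \<le> 1/2" "2 * \<epsilon> < e" using e(1) by (auto simp: \<epsilon>_def)
    \<comment> \<open>Elements of \<open>cfunspace\<close> are extensional, hence
      \<open>restrict\<close>.\<close>
    define g where "g = restrict (\<lambda>x. f a + \<epsilon> * dist x a) \<Delta>"
    have gcont: "continuous_on \<Delta> g"
      by (rule continuous_on_cong[THEN iffD2, OF refl _ ])
         (auto simp: g_def intro!: continuous_intros)
    have "bounded (g ` \<Delta>)"
      by (rule compact_imp_bounded[OF compact_continuous_image[OF gcont compact_sierpinski]])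
    then have gM: "g \<in> mspace cfun"
      using gcont by (simp add: g_def mbounded_iff_bounded)
    have "holder1_on \<alpha> \<Delta> g"
      unfolding holder1_on_def
    proof (intro ballI)
      fix x y assume xy: "x \<in> \<Delta>" "y \<in> \<Delta>"
      have "\<bar>g x - g y\<bar> = \<epsilon> * \<bar>dist x a - dist y a\<bar>"
        using xy \<epsilon>(1) by (simp add: g_def abs_mult right_diff_distrib[symmetric])
      also have "\<dots> \<le> 1/2 * dist x y"
        using \<epsilon> abs_dist_diff_le[of x a y] by (intro mult_mono) (auto simp: dist_commute)
      also have "\<dots> \<le> dist x y powr \<alpha>"
      proof (cases "x = y")
        case False
        let ?d = "dist x y"
        have d: "0 < ?d" "?d \<le> 2" using False dist_sierpinski_le[OF xy] by auto
        have "?d = ?d powr \<alpha> * ?d powr (1 - \<alpha>)" using d by (simp flip: powr_add)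
        also have "\<dots> \<le> ?d powr \<alpha> * 2"
        proof (rule mult_left_mono)
          have "?d powr (1 - \<alpha>) \<le> 2 powr (1 - \<alpha>)" using d \<alpha> by (intro powr_mono2) auto
          also have "\<dots> \<le> 2 powr 1" using \<alpha> by (intro powr_mono) auto
          finally show "?d powr (1 - \<alpha>) \<le> 2" by simp
        qed simp
        finally show ?thesis by simp
      qed simp
      finally show "\<bar>g x - g y\<bar> \<le> dist x y powr \<alpha>" .
    qed
    then have gH: "g \<in> topspace (holder1_space \<alpha> \<Delta>)"
      using gM unfolding topspace_holder1_space by blast
    have "g a \<noteq> g b"
      using ab_in_sierpinski \<epsilon>(1) dist_ab by (simp add: g_def dist_commute)
    with gH have "g \<in> nonconstant \<alpha>"
      unfolding nonconstant_def using ab_in_sierpinski by blast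
    moreover have "mdist cfun f g \<le> 2 * \<epsilon>"
    proof (rule mdist_cfunspace_le)
      fix x assume "x \<in> topspace (top_of_set \<Delta>)"
      then have x: "x \<in> \<Delta>" by simp
      have "\<epsilon> * dist x a \<le> \<epsilon> * 2"
        using \<epsilon>(1) dist_sierpinski_le[OF x ab_in_sierpinski(1)] by simp
      then show "mdist euclidean_metric (f x) (g x) \<le> 2 * \<epsilon>"
        using x \<epsilon>(1) const[OF x] by (simp add: g_def dist_real_def)
    qed (use \<epsilon> in simp)
    then have "g \<in> M.mball f e" using fM gM \<epsilon>(3) by (simp del: mspace_cfunspace)
    then have "g \<in> T" using e(2) gH unfolding T'(2) topspace_holder1_space by blast
    ultimately show ?thesis by blast
  qed
  then show "f \<in> holder1_space \<alpha> \<Delta> closure_of nonconstant \<alpha>"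
    using f unfolding in_closure_of by blast
qed

text \<open>The open dense set of nonconstant functions is one competitor in the supremum, and each
  of its members satisfies the bound.\<close>

lemma D_lower_box_ge:
  assumes \<alpha>: "0 < \<alpha>" "\<alpha> \<le> 1"
  shows "D_lower_box \<alpha> \<Delta> \<ge> ereal (h_B_inv \<alpha>)"
proof -
  have "nonconstant \<alpha> \<in> dense_gdeltas \<alpha> \<Delta>"
    unfolding dense_gdeltas_def
    using open_imp_gdelta_in[OF openin_nonconstant] nonconstant_dense[OF \<alpha>] by blast
  moreover have "D_lower_box_fun f \<Delta> \<ge> ereal (h_B_inv \<alpha>)" if "f \<in> nonconstant \<alpha>" for f
  proof -
    have f: "holder1_on \<alpha> \<Delta> f" and "\<exists>x\<in>\<Delta>. \<exists>y\<in>\<Delta>. f x \<noteq> f y"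
      using that unfolding nonconstant_def topspace_holder1_space by blast+
    then obtain x y where "x \<in> \<Delta>" "y \<in> \<Delta>" "f x \<noteq> f y" by blast
    then show ?thesis
      using D_lower_box_fun_ge[OF \<alpha> f] by (metis linorder_neqE_linordered_idom)
  qed
  ultimately show ?thesis
    unfolding D_lower_box_def by (meson INF_greatest SUP_upper2)
qed

end

theorem theorem3p7:
  fixes a b c :: "real ^ 2" and \<alpha> :: real
  assumes "dist a b = 1" and "dist b c = 1" and "dist a c = 1"
    and "0 < \<alpha>" and "\<alpha> \<le> 1"
  shows "(\<forall>f. holder1_on \<alpha> (sierpinski a b c) f \<longrightarrow>
            (AE r in lebesgue. r \<in> f ` sierpinski a b c \<longrightarrow>
               lower_box_dim (level_set (sierpinski a b c) f r) \<ge> ereal (h_B_inv \<alpha>))) \<and>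
         D_lower_box \<alpha> (sierpinski a b c) \<ge> ereal (h_B_inv \<alpha>)"
proof -
  interpret unit_triangle a b c by unfold_locales (fact assms)+
  show ?thesis
    using AE_lower_box_dim_level_set[OF assms(4,5)] D_lower_box_ge[OF assms(4,5)] by blast
qed

end
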